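(* Suppose $\Omega\subset\mathbb{C}^d$ is a bounded convex domain and $\partial\Omega$ is $C^1$. If $\epsilon>0$ and $z_0\in\Omega$, then there exists $B=B(\epsilon,z_0)>0$ such that $$K_\Omega(q,z_0)\le B+\frac{1+\epsilon}{2}\log\frac{1}{\delta_\Omega(q)}$$ for all $q\in\Omega$. In particular, $\alpha_\star(\Omega)=1$.
   Context: $\delta_\Omega(q)=\inf\{\|q-w\|:w\in\partial\Omega\}$ (Euclidean distance). Kobayashi distance: $K_\Omega(x,y)$ is the infimum of $\int_a^b k_\Omega(\sigma(t);\sigma'(t))\,dt$ over absolutely continuous curves $\sigma:[a,b]\to\Omega$ from $x$ to $y$, where $k_\Omega(x;v)=\inf\{|\zeta|: f:\mathbb{D}\to\Omega \text{ holomorphic}, f(0)=x, f'(0)\zeta=v\}$ and $\mathbb{D}$ is the unit disk in $\mathbb{C}$. A bounded convex domain $\Omega$ is $\alpha$-regular if for any $z_0\in\Omega$ there is $B=B(\alpha,z_0)>0$ with $K_\Omega(q,z_0)\le B+\frac{\alpha}{2}\log\frac{1}{\delta_\Omega(q)}$ for all $q\in\Omega$, and $\alpha_\star(\Omega):=\inf\{\alpha>0:\Omega\text{ is }\alpha\text{-regular}\}$. *)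

theory Defs
  imports "HOL-Analysis.Analysis"
begin

definition bounded_convex_domain :: "(complex ^ 'd) set \<Rightarrow> bool" where
  "bounded_convex_domain \<Omega> \<longleftrightarrow> \<Omega> \<noteq> {} \<and> open \<Omega> \<and> bounded \<Omega> \<and> convex \<Omega>"

text \<open>\<open>C\<^sup>1\<close> boundary, by local defining functions. The ambient space is regarded as a real
  inner product space, and \<open>g\<close> is the (real) gradient of \<open>r\<close>.\<close>

definition C1_boundary :: "'a::euclidean_space set \<Rightarrow> bool" where
  "C1_boundary \<Omega> \<longleftrightarrow>
    (\<forall>p\<in>frontier \<Omega>. \<exists>U (r :: 'a \<Rightarrow> real) (g :: 'a \<Rightarrow> 'a).
      open U \<and> p \<in> U \<and>
      (\<forall>x\<in>U. (r has_derivative (\<lambda>h. g x \<bullet> h)) (at x)) \<and>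
      continuous_on U g \<and> (\<forall>x\<in>U. g x \<noteq> 0) \<and>
      \<Omega> \<inter> U = {x\<in>U. r x < 0})"

definition bdist :: "'a::euclidean_space set \<Rightarrow> 'a \<Rightarrow> real" where
  "bdist \<Omega> q = infdist q (frontier \<Omega>)"

definition holomorphic_vec :: "(complex \<Rightarrow> complex ^ 'd) \<Rightarrow> complex set \<Rightarrow> bool" where
  "holomorphic_vec f S \<longleftrightarrow> (\<forall>i. (\<lambda>z. f z $ i) holomorphic_on S)"

definition deriv_vec :: "(complex \<Rightarrow> complex ^ 'd) \<Rightarrow> complex \<Rightarrow> complex ^ 'd" where
  "deriv_vec f z = (\<chi> i. deriv (\<lambda>w. f w $ i) z)"

definition kobayashi_metric :: "(complex ^ 'd) set \<Rightarrow> complex ^ 'd \<Rightarrow> complex ^ 'd \<Rightarrow> real" where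
  "kobayashi_metric \<Omega> x v =
    Inf {cmod \<zeta> | \<zeta>. \<exists>f. holomorphic_vec f (ball 0 1) \<and> f ` ball 0 1 \<subseteq> \<Omega> \<and>
                       f 0 = x \<and> \<zeta> *s deriv_vec f 0 = v}"

definition abs_continuous_curve :: "real \<Rightarrow> real \<Rightarrow> (real \<Rightarrow> 'a::real_normed_vector) \<Rightarrow> bool" where
  "abs_continuous_curve a b \<sigma> \<longleftrightarrow>
    (\<forall>\<epsilon>>0. \<exists>\<delta>>0. \<forall>(n::nat) s t.
      (\<forall>i<n. a \<le> s i \<and> s i \<le> t i \<and> t i \<le> b) \<and>
      disjoint_family_on (\<lambda>i. {s i<..<t i}) {..<n} \<and>
      (\<Sum>i<n. t i - s i) < \<delta>
      \<longrightarrow> (\<Sum>i<n. norm (\<sigma> (t i) - \<sigma> (s i))) < \<epsilon>)"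

text \<open>An absolutely continuous curve is differentiable almost everywhere on its interval, so the
  unspecified value of \<^const>\<open>vector_derivative\<close> at other points does not affect the length.
  Lengths and distances are extended-valued, so that no convention for divergent integrals or
  for the infimum over an empty set of curves is involved.\<close>

definition kobayashi_length ::
    "(complex ^ 'd) set \<Rightarrow> real \<Rightarrow> real \<Rightarrow> (real \<Rightarrow> complex ^ 'd) \<Rightarrow> ennreal" where
  "kobayashi_length \<Omega> a b \<sigma> =
    (\<integral>\<^sup>+ t\<in>{a..b}. ennreal (kobayashi_metric \<Omega> (\<sigma> t) (vector_derivative \<sigma> (at t))) \<partial>lebesgue)"

definition kobayashi_dist :: "(complex ^ 'd) set \<Rightarrow> complex ^ 'd \<Rightarrow> complex ^ 'd \<Rightarrow> ereal" where
  "kobayashi_dist \<Omega> x y =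
    enn2ereal (Inf {kobayashi_length \<Omega> a b \<sigma> | a b \<sigma>.
      a < b \<and> abs_continuous_curve a b \<sigma> \<and> \<sigma> ` {a..b} \<subseteq> \<Omega> \<and> \<sigma> a = x \<and> \<sigma> b = y})"

definition alpha_regular :: "real \<Rightarrow> (complex ^ 'd) set \<Rightarrow> bool" where
  "alpha_regular \<alpha> \<Omega> \<longleftrightarrow>
    (\<forall>z0\<in>\<Omega>. \<exists>B>0. \<forall>q\<in>\<Omega>.
      kobayashi_dist \<Omega> q z0 \<le> ereal (B + \<alpha> / 2 * ln (1 / bdist \<Omega> q)))"

definition alpha_star :: "(complex ^ 'd) set \<Rightarrow> real" where
  "alpha_star \<Omega> = Inf {\<alpha>. \<alpha> > 0 \<and> alpha_regular \<alpha> \<Omega>}"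

end

theory Submission
  imports Defs "HOL-Complex_Analysis.Complex_Analysis"
begin

text \<open>
  Upper bound: since the boundary is \<open>C\<^sup>1\<close> and compact and the domain is convex, for every
  \<open>s < 1\<close> there is \<open>c\<^sub>0\<close> such that \<open>B(p + c n, s c)\<close> lies in the domain for all boundary points
  \<open>p\<close> with inner normal \<open>n\<close> and all \<open>c \<le> c\<^sub>0\<close>. At \<open>p + t n\<close>, a disc of this kind with \<open>c\<close> a large
  multiple of \<open>t\<close> shows that the Kobayashi metric in direction \<open>n\<close> is at most \<open>(1 + \<epsilon>) / (2 t)\<close>.
  Integrating along the normal from the boundary point closest to \<open>q\<close>, and then following a
  segment to \<open>z\<^sub>0\<close>, gives the estimate.

  Lower bound: by the Schwarz lemma the Kobayashi metric dominates that of a supporting half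
  space, so the length of a curve \<open>\<sigma>\<close> is at least the increment of \<open>ln (n \<bullet> (\<sigma> - p)) / 2\<close>. For
  absolutely continuous curves this rests on differentiability almost everywhere and on the
  inequality between the increment and the integral of the absolute value of the derivative.
  Applied to points tending to \<open>p\<close> along a segment, it yields \<open>\<alpha> \<ge> 1\<close>.
\<close>

section \<open>Absolutely continuous curves\<close>

text \<open>The factor \<open>1 / 2\<close> comes from the half plane, whose metric is one over
  twice the distance to its edge. A \<open>C^1\<close> boundary need not admit tangent interior
  balls of uniform size, so a ball of radius \<open>c\<close> about \<open>p + c n\<close> is out of
  reach; a ball of radius \<open>s * c\<close> leaves a gap of \<open>(1 - s) * c\<close> at
  \<open>p\<close>. The parameter \<open>l\<close> balances two errors: with
  \<open>c = t / l\<close> and \<open>s = 1 - l^2\<close> the gap is \<open>l * t\<close>, small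
  against \<open>t\<close>, while \<open>c\<close> is large against \<open>t\<close>, so that near
  \<open>p + t n\<close> the disc resembles a half plane with edge at distance
  \<open>(1 - l) * t\<close>. This costs the factor \<open>(1 + l) / (1 - l)\<close>, hence the
  \<epsilon>. The lower bound has to treat every absolutely continuous curve, and
  \<open>kobayashi_length\<close> evaluates \<open>vector_derivative\<close>, an unspecified value
  wherever the curve is not differentiable. The bound therefore depends on that set being null,
  which is derived from the total variation and the Vitali covering theorem. The upper bound needs
  none of this, since its curves consist of two affine pieces.\<close>

lemma abs_continuous_curve_finite_family:
  assumes "abs_continuous_curve a b \<sigma>" "e > 0"
  shows "\<exists>d>0. \<forall>I (s :: 'i \<Rightarrow> real) t. finite I \<and> (\<forall>i\<in>I. a \<le> s i \<and> s i \<le> t i \<and> t i \<le> b) \<and>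
        disjoint_family_on (\<lambda>i. {s i<..<t i}) I \<and> (\<Sum>i\<in>I. t i - s i) < d
      \<longrightarrow> (\<Sum>i\<in>I. norm (\<sigma> (t i) - \<sigma> (s i))) < e"
proof -
  obtain d where "d > 0" and d: "\<And>(n::nat) s t.
      (\<forall>i<n. a \<le> s i \<and> s i \<le> t i \<and> t i \<le> b) \<and>
      disjoint_family_on (\<lambda>i. {s i<..<t i}) {..<n} \<and> (\<Sum>i<n. t i - s i) < d
      \<Longrightarrow> (\<Sum>i<n. norm (\<sigma> (t i) - \<sigma> (s i))) < e"
    using assms unfolding abs_continuous_curve_def by meson
  have "(\<Sum>i\<in>I. norm (\<sigma> (t i) - \<sigma> (s i))) < e"
    if I: "finite I" "\<forall>i\<in>I. a \<le> s i \<and> s i \<le> t i \<and> t i \<le> b"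
        "disjoint_family_on (\<lambda>i. {s i<..<t i}) I" "(\<Sum>i\<in>I. t i - s i) < d"
    for I and s t :: "'i \<Rightarrow> real"
  proof -
    \<comment> \<open>The definition indexes intervals by an initial segment of \<open>nat\<close>.
      Later families are indexed by the pieces of a tagged division, so the indices are renumbered
      here.\<close>
    obtain f where f: "bij_betw f {..<card I} I"
      using ex_bij_betw_nat_finite[OF \<open>finite I\<close>] by (auto simp: atLeast0LessThan)
    have fI: "f i \<in> I" if "i < card I" for i
      using f that by (auto dest: bij_betwE)
    have inj: "f i \<noteq> f j" if "i < card I" "j < card I" "i \<noteq> j" for i j
      using f that by (auto simp: bij_betw_def inj_on_def)
    have "(\<Sum>i<card I. norm (\<sigma> ((t \<circ> f) i) - \<sigma> ((s \<circ> f) i))) < e"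
    proof (rule d, intro conjI allI impI)
      show "disjoint_family_on (\<lambda>i. {(s \<circ> f) i<..<(t \<circ> f) i}) {..<card I}"
        using I(3) fI inj unfolding disjoint_family_on_def by simp
      show "(\<Sum>i<card I. (t \<circ> f) i - (s \<circ> f) i) < d"
        using sum.reindex_bij_betw[OF f, of "\<lambda>i. t i - s i"] I(4) by simp
    qed (use I(2) fI in auto)
    then show ?thesis
      using sum.reindex_bij_betw[OF f, of "\<lambda>i. norm (\<sigma> (t i) - \<sigma> (s i))"] by simp
  qed
  then show ?thesis using \<open>d > 0\<close> by blast
qed

text \<open>Each summand of the bound receives half of \<open>e\<close>. The \<open>L\<close> term
  serves Lipschitz functions of the curve (components, logarithms), the \<open>M\<close> term serves
  added linear functions and Lipschitz curves.\<close>

lemma abs_continuous_curve_dominated: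
  assumes \<sigma>: "abs_continuous_curve a b \<sigma>"
    and le: "\<And>s t. \<lbrakk>a \<le> s; s \<le> t; t \<le> b\<rbrakk> \<Longrightarrow> norm (\<tau> t - \<tau> s) \<le> L * norm (\<sigma> t - \<sigma> s) + M * (t - s)"
  shows "abs_continuous_curve a b \<tau>"
  unfolding abs_continuous_curve_def
proof (intro allI impI)
  fix e :: real assume "e > 0"
  \<comment> \<open>The constants \<open>L\<close> and \<open>M\<close> may be zero or negative;
    positive majorants can be divided by.\<close>
  define L' where "L' = \<bar>L\<bar> + 1"
  define M' where "M' = \<bar>M\<bar> + 1"
  have pos: "L' > 0" "M' > 0" by (auto simp: L'_def M'_def)
  have "e / (2 * L') > 0" using \<open>e > 0\<close> pos by simp
  then obtain d where "d > 0" and d: "\<And>(n::nat) s t.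
      (\<forall>i<n. a \<le> s i \<and> s i \<le> t i \<and> t i \<le> b) \<and>
      disjoint_family_on (\<lambda>i. {s i<..<t i}) {..<n} \<and> (\<Sum>i<n. t i - s i) < d
      \<Longrightarrow> (\<Sum>i<n. norm (\<sigma> (t i) - \<sigma> (s i))) < e / (2 * L')"
    using \<sigma> unfolding abs_continuous_curve_def by meson
  show "\<exists>\<delta>>0. \<forall>(n::nat) s t. (\<forall>i<n. a \<le> s i \<and> s i \<le> t i \<and> t i \<le> b) \<and>
      disjoint_family_on (\<lambda>i. {s i<..<t i}) {..<n} \<and> (\<Sum>i<n. t i - s i) < \<delta>
      \<longrightarrow> (\<Sum>i<n. norm (\<tau> (t i) - \<tau> (s i))) < e"
  proof (intro exI[of _ "min d (e / (2 * M'))"] conjI allI impI)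
    show "min d (e / (2 * M')) > 0" using \<open>d > 0\<close> \<open>e > 0\<close> pos by simp
    fix n :: nat and s t :: "nat \<Rightarrow> real"
    assume H: "(\<forall>i<n. a \<le> s i \<and> s i \<le> t i \<and> t i \<le> b) \<and>
      disjoint_family_on (\<lambda>i. {s i<..<t i}) {..<n} \<and> (\<Sum>i<n. t i - s i) < min d (e / (2 * M'))"
    have "norm (\<tau> (t i) - \<tau> (s i)) \<le> L' * norm (\<sigma> (t i) - \<sigma> (s i)) + M' * (t i - s i)" if "i < n" for i
    proof -
      have st: "a \<le> s i" "s i \<le> t i" "t i \<le> b" using H that by auto
      have "L * norm (\<sigma> (t i) - \<sigma> (s i)) \<le> L' * norm (\<sigma> (t i) - \<sigma> (s i))"
        by (intro mult_right_mono) (auto simp: L'_def)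
      moreover have "M * (t i - s i) \<le> M' * (t i - s i)"
        using st by (intro mult_right_mono) (auto simp: M'_def)
      ultimately show ?thesis using le[OF st] by linarith
    qed
    then have "(\<Sum>i<n. norm (\<tau> (t i) - \<tau> (s i)))
        \<le> (\<Sum>i<n. L' * norm (\<sigma> (t i) - \<sigma> (s i)) + M' * (t i - s i))"
      by (intro sum_mono) auto
    also have "\<dots> = L' * (\<Sum>i<n. norm (\<sigma> (t i) - \<sigma> (s i))) + M' * (\<Sum>i<n. t i - s i)"
      by (simp add: sum.distrib sum_distrib_left)
    also have "\<dots> < L' * (e / (2 * L')) + M' * (e / (2 * M'))"
      using H d[of n s t] pos by (intro add_strict_mono mult_strict_left_mono) auto
    also have "\<dots> = e" using pos by (simp add: field_simps)
    finally show "(\<Sum>i<n. norm (\<tau> (t i) - \<tau> (s i))) < e" .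
  qed
qed

lemma Lipschitz_imp_abs_continuous_curve:
  fixes \<tau> :: "real \<Rightarrow> 'a::real_normed_vector"
  assumes "\<And>s t. \<lbrakk>a \<le> s; s \<le> t; t \<le> b\<rbrakk> \<Longrightarrow> norm (\<tau> t - \<tau> s) \<le> M * (t - s)"
  shows "abs_continuous_curve a b \<tau>"
proof (rule abs_continuous_curve_dominated)
  show "abs_continuous_curve a b (\<lambda>_. 0::real)"
    unfolding abs_continuous_curve_def by (auto intro: exI[of _ 1])
qed (use assms in auto)

lemma abs_continuous_curve_imp_continuous_on:
  assumes "abs_continuous_curve a b \<sigma>"
  shows "continuous_on {a..b} \<sigma>"
  unfolding continuous_on_iff
proof (intro ballI allI impI)
  fix x e :: real assume "x \<in> {a..b}" "e > 0"
  obtain d where "d > 0" and d: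
    "\<forall>I (s :: unit \<Rightarrow> real) t. finite I \<and> (\<forall>i\<in>I. a \<le> s i \<and> s i \<le> t i \<and> t i \<le> b) \<and>
        disjoint_family_on (\<lambda>i. {s i<..<t i}) I \<and> (\<Sum>i\<in>I. t i - s i) < d
      \<longrightarrow> (\<Sum>i\<in>I. norm (\<sigma> (t i) - \<sigma> (s i))) < e"
    using abs_continuous_curve_finite_family[OF assms \<open>e > 0\<close>] by blast
  have *: "norm (\<sigma> t - \<sigma> s) < e" if "a \<le> s" "s \<le> t" "t \<le> b" "t - s < d" for s t
    using d[rule_format, of "{()}" "\<lambda>_. s" "\<lambda>_. t"] that by (simp add: disjoint_family_on_def)
  have "dist (\<sigma> y) (\<sigma> x) < e" if "y \<in> {a..b}" "dist y x < d" for y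
    using *[of x y] *[of y x] that \<open>x \<in> {a..b}\<close>
    by (cases "x \<le> y") (auto simp: dist_norm norm_minus_commute abs_real_def split: if_splits)
  then show "\<exists>d>0. \<forall>y\<in>{a..b}. dist y x < d \<longrightarrow> dist (\<sigma> y) (\<sigma> x) < e"
    using \<open>d > 0\<close> by blast
qed

lemma abs_continuous_curve_subinterval:
  assumes "abs_continuous_curve a b \<sigma>" "a \<le> c" "d \<le> b"
  shows "abs_continuous_curve c d \<sigma>"
  using assms unfolding abs_continuous_curve_def
  by (meson order_trans)

section \<open>Total variation of an absolutely continuous curve\<close>

definition variation_sums :: "(real \<Rightarrow> 'a::real_normed_vector) \<Rightarrow> real \<Rightarrow> real \<Rightarrow> real set" where
  "variation_sums w a b =
    {(\<Sum>i<n. norm (w (x (Suc i)) - w (x i))) |x n. mono x \<and> x 0 = a \<and> x n = b}"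

lemma variation_sums_split:
  assumes "V \<in> variation_sums w a b" "a \<le> c" "c \<le> b"
  obtains V1 V2 where "V1 \<in> variation_sums w a c" "V2 \<in> variation_sums w c b" "V \<le> V1 + V2"
proof -
  obtain x n where x: "mono x" "x 0 = a" "x n = b" "V = (\<Sum>i<n. norm (w (x (Suc i)) - w (x i)))"
    using assms unfolding variation_sums_def by blast
  \<comment> \<open>Repeated partition points are allowed and contribute zero, so clipping at
    \<open>c\<close> from either side gives partitions with the same \<open>n\<close>. Only a step
    across \<open>c\<close> needs the triangle inequality.\<close>
  define y where "y i = min (x i) c" for i
  define z where "z i = max (x i) c" for i
  have *: "norm (w (x (Suc i)) - w (x i))
      \<le> norm (w (y (Suc i)) - w (y i)) + norm (w (z (Suc i)) - w (z i))" for i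
  proof -
    have "x i \<le> x (Suc i)" using x(1) by (simp add: monoD)
    moreover have "norm (w (x (Suc i)) - w (x i)) \<le> norm (w c - w (x i)) + norm (w (x (Suc i)) - w c)"
      using norm_triangle_ineq[of "w c - w (x i)" "w (x (Suc i)) - w c"] by simp
    ultimately show ?thesis
      by (cases "x i \<le> c"; cases "x (Suc i) \<le> c") (auto simp: y_def z_def min_def max_def)
  qed
  show thesis
  proof (rule that)
    show "(\<Sum>i<n. norm (w (y (Suc i)) - w (y i))) \<in> variation_sums w a c"
      unfolding variation_sums_def mem_Collect_eq
      by (intro exI[of _ y] exI[of _ n]) (use x assms in \<open>auto simp: y_def mono_def min.coboundedI1\<close>)
    show "(\<Sum>i<n. norm (w (z (Suc i)) - w (z i))) \<in> variation_sums w c b"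
      unfolding variation_sums_def mem_Collect_eq
      by (intro exI[of _ z] exI[of _ n]) (use x assms in \<open>auto simp: z_def mono_def max.coboundedI1\<close>)
    show "V \<le> (\<Sum>i<n. norm (w (y (Suc i)) - w (y i))) + (\<Sum>i<n. norm (w (z (Suc i)) - w (z i)))"
      unfolding x(4) sum.distrib[symmetric] by (intro sum_mono *)
  qed
qed

lemma bdd_above_variation_sums_join:
  assumes "bdd_above (variation_sums w a c)" "bdd_above (variation_sums w c b)" "a \<le> c" "c \<le> b"
  shows "bdd_above (variation_sums w a b)"
proof -
  obtain M1 M2 where "\<And>V. V \<in> variation_sums w a c \<Longrightarrow> V \<le> M1" "\<And>V. V \<in> variation_sums w c b \<Longrightarrow> V \<le> M2"
    using assms unfolding bdd_above_def by blast
  then have "V \<le> M1 + M2" if "V \<in> variation_sums w a b" for V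
    using variation_sums_split[OF that \<open>a \<le> c\<close> \<open>c \<le> b\<close>] by (metis add_mono order_trans)
  then show ?thesis by (rule bdd_aboveI)
qed

lemma variation_sums_append:
  assumes "V \<in> variation_sums w a c" "c \<le> b"
  shows "V + norm (w b - w c) \<in> variation_sums w a b"
proof -
  obtain x n where x: "mono x" "x 0 = a" "x n = c" "V = (\<Sum>i<n. norm (w (x (Suc i)) - w (x i)))"
    using assms unfolding variation_sums_def by blast
  define y where "y i = (if i \<le> n then x i else b)" for i
  have "x i \<le> b" if "i \<le> n" for i
    using monoD[OF x(1) that] x(3) assms(2) by simp
  then have "mono y"
    using x(1) by (auto simp: y_def mono_def)
  moreover have "(\<Sum>i<Suc n. norm (w (y (Suc i)) - w (y i))) = V + norm (w b - w c)"
    using x by (simp add: y_def)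
  ultimately show ?thesis
    unfolding variation_sums_def mem_Collect_eq
    by (intro exI[of _ y] exI[of _ "Suc n"]) (use x in \<open>auto simp: y_def\<close>)
qed

lemma variation_sums_nonempty:
  assumes "a \<le> b"
  shows "norm (w b - w a) \<in> variation_sums w a b"
proof -
  have "0 \<in> variation_sums w a a"
    unfolding variation_sums_def by (auto intro!: exI[of _ "\<lambda>_. a"] exI[of _ 0] simp: mono_def)
  from variation_sums_append[OF this assms] show ?thesis by simp
qed

text \<open>The \<delta> belonging to \<epsilon> = 1 bounds all sums on an interval shorter than
  \<open>d\<close> by 1. Finitely many steps of length \<open>d / 2\<close>, truncated at
  \<open>b\<close>, reach from \<open>a\<close> to \<open>b\<close>.\<close>

lemma abs_continuous_curve_imp_bdd_above_variation_sums:
  assumes ac: "abs_continuous_curve a b w" and "a \<le> b"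
  shows "bdd_above (variation_sums w a b)"
proof -
  obtain d where "d > 0" and d:
    "\<forall>(n::nat) s t. (\<forall>i<n. a \<le> s i \<and> s i \<le> t i \<and> t i \<le> b) \<and>
      disjoint_family_on (\<lambda>i. {s i<..<t i}) {..<n} \<and> (\<Sum>i<n. t i - s i) < d
      \<longrightarrow> (\<Sum>i<n. norm (w (t i) - w (s i))) < 1"
    using ac zero_less_one unfolding abs_continuous_curve_def by blast
  have short: "bdd_above (variation_sums w s t)" if "a \<le> s" "s \<le> t" "t \<le> b" "t - s < d" for s t
  proof (rule bdd_aboveI)
    fix V assume "V \<in> variation_sums w s t"
    then obtain x n where x: "mono x" "x 0 = s" "x n = t" "V = (\<Sum>i<n. norm (w (x (Suc i)) - w (x i)))"
      unfolding variation_sums_def by blast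
    have "(\<Sum>i<n. norm (w (x (Suc i)) - w (x i))) < 1"
    proof (rule d[rule_format], intro conjI allI impI)
      fix i assume "i < n"
      then have "s \<le> x i" "x i \<le> x (Suc i)" "x (Suc i) \<le> t"
        using monoD[OF x(1), of 0 i] monoD[OF x(1), of i "Suc i"] monoD[OF x(1), of "Suc i" n] x by auto
      then show "a \<le> x i" "x i \<le> x (Suc i)" "x (Suc i) \<le> b" using that by auto
    next
      have "{x i<..<x (Suc i)} \<inter> {x j<..<x (Suc j)} = {}" if "i < j" for i j
        using monoD[OF x(1), of "Suc i" j] that by auto
      then show "disjoint_family_on (\<lambda>i. {x i<..<x (Suc i)}) {..<n}"
        unfolding disjoint_family_on_def by (metis inf_commute linorder_neqE_nat)
      show "(\<Sum>i<n. x (Suc i) - x i) < d"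
        using x that by (simp add: sum_lessThan_telescope)
    qed
    then show "V \<le> 1" using x by simp
  qed
  have "bdd_above (variation_sums w a (min b (a + real n * (d / 2))))" for n
  proof (induction n)
    case 0
    then show ?case using short[of a a] \<open>d > 0\<close> \<open>a \<le> b\<close> by simp
  next
    case (Suc n)
    show ?case
    proof (rule bdd_above_variation_sums_join[OF Suc.IH])
      show "bdd_above (variation_sums w (min b (a + real n * (d / 2))) (min b (a + real (Suc n) * (d / 2))))"
        using \<open>d > 0\<close> \<open>a \<le> b\<close> by (intro short) (auto simp: min_def field_simps)
    qed (use \<open>d > 0\<close> \<open>a \<le> b\<close> in \<open>auto simp: min_def field_simps\<close>)
  qed
  moreover obtain n where "(b - a) / (d / 2) < real n"
    using reals_Archimedean2 by blast
  then have "b < a + real n * (d / 2)" using \<open>d > 0\<close> by (simp add: field_simps)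
  ultimately show ?thesis by (metis min.absorb1 less_imp_le)
qed

definition variation :: "(real \<Rightarrow> 'a::real_normed_vector) \<Rightarrow> real \<Rightarrow> real \<Rightarrow> real" where
  "variation w a t = Sup (variation_sums w a t)"

text \<open>Appending \<open>t\<close> to a partition of \<open>{a..s}\<close> adds
  \<open>norm (w t - w s)\<close> to its sum. For real \<open>w\<close> this makes the variation
  \<open>T\<close> as well as \<open>T - w\<close> and \<open>T + w\<close> monotone, and the
  covering arguments act on these functions.\<close>

lemma variation_increment:
  assumes ac: "abs_continuous_curve a b w" and st: "a \<le> s" "s \<le> t" "t \<le> b"
  shows "norm (w t - w s) \<le> variation w a t - variation w a s"
proof -
  have bdd: "bdd_above (variation_sums w a t)"
    using ac st abs_continuous_curve_subinterval abs_continuous_curve_imp_bdd_above_variation_sums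
    by (metis order_refl order_trans)
  have "variation w a s \<le> variation w a t - norm (w t - w s)"
    unfolding variation_def
  proof (rule cSup_least)
    show "variation_sums w a s \<noteq> {}" using variation_sums_nonempty[OF st(1)] by blast
    fix V assume "V \<in> variation_sums w a s"
    from cSup_upper[OF variation_sums_append[OF this st(2)] bdd]
    show "V \<le> Sup (variation_sums w a t) - norm (w t - w s)" by simp
  qed
  then show ?thesis by simp
qed

section \<open>Vitali coverings and differentiability almost everywhere\<close>

lemma sum_increments_disjoint_intervals_le:
  fixes F :: "real \<Rightarrow> real"
  assumes "finite P"
    and "\<And>x y. \<lbrakk>a \<le> x; x \<le> y; y \<le> b\<rbrakk> \<Longrightarrow> F x \<le> F y" "a \<le> b"
    and "\<And>p. p \<in> P \<Longrightarrow> a \<le> fst p \<and> fst p \<le> snd p \<and> snd p \<le> b"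
    and "pairwise (\<lambda>p q. disjnt {fst p..snd p} {fst q..snd q}) P"
  shows "(\<Sum>p\<in>P. F (snd p) - F (fst p)) \<le> F b - F a"
  using assms
\<comment> \<open>The interval with the largest right endpoint is added last. Disjointness puts all
  others to the left of \<open>fst p\<close>, so the induction hypothesis is used with
  \<open>fst p\<close> in place of \<open>b\<close>.\<close>
proof (induction P arbitrary: b rule: finite_ranking_induct[where f = snd])
  case empty
  then show ?case by simp
next
  case (insert p P)
  show ?case
  proof (cases "p \<in> P")
    case True
    then show ?thesis using insert.IH insert.prems by (simp add: insert_absorb)
  next
    case False
    have p: "a \<le> fst p" "fst p \<le> snd p" "snd p \<le> b" using insert.prems by auto
    have "snd q \<le> fst p" if "q \<in> P" for q
    proof -
      have "disjnt {fst p..snd p} {fst q..snd q}"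
        using insert.prems(4) that False unfolding pairwise_insert by blast
      moreover have "snd q \<le> snd p" "fst q \<le> snd q"
        using that insert by auto
      ultimately show ?thesis by (auto simp: disjnt_iff)
    qed
    note le = this
    have "(\<Sum>q\<in>P. F (snd q) - F (fst q)) \<le> F (fst p) - F a"
    proof (rule insert.IH)
      show "F x \<le> F y" if "a \<le> x" "x \<le> y" "y \<le> fst p" for x y
        using insert.prems(1)[of x y] that p by linarith
      show "pairwise (\<lambda>p q. disjnt {fst p..snd p} {fst q..snd q}) P"
        using insert.prems(4) by (simp add: pairwise_insert)
    qed (use insert.prems(3) p le in auto)
    moreover have "F (snd p) \<le> F b" using insert.prems(1)[of "snd p" b] p by linarith
    ultimately show ?thesis using False insert.hyps by simp
  qed
qed

text \<open>The steep intervals form a Vitali cover of \<open>E\<close>. A disjoint subfamily covers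
  \<open>E\<close> up to a null set, and on each of its members the length is at most the increment
  of \<open>F\<close> divided by \<open>c\<close>; by monotonicity these increments add up to at
  most \<open>F b - F a\<close>.\<close>

lemma mono_steep_set_outer_measure:
  fixes F :: "real \<Rightarrow> real"
  assumes mono: "\<And>x y. \<lbrakk>a \<le> x; x \<le> y; y \<le> b\<rbrakk> \<Longrightarrow> F x \<le> F y" and "a \<le> b" "c > 0"
    and steep: "\<And>t d. \<lbrakk>t \<in> E; d > 0\<rbrakk> \<Longrightarrow>
      \<exists>x y. a \<le> x \<and> x < y \<and> y \<le> b \<and> x \<le> t \<and> t \<le> y \<and> y - x < d \<and> c * (y - x) \<le> F y - F x"
  obtains U where "U \<in> lmeasurable" "E \<subseteq> U" "measure lebesgue U \<le> (F b - F a) / c"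
proof -
  define K where "K = {p. a \<le> fst p \<and> fst p < snd p \<and> snd p \<le> b \<and> c * (snd p - fst p) \<le> F (snd p) - F (fst p)}"
  \<comment> \<open>The covering theorem speaks of closed balls, so each interval is given by its
    midpoint and half length.\<close>
  define m where "m p = (fst p + snd p) / 2" for p :: "real \<times> real"
  define r where "r p = (snd p - fst p) / 2" for p :: "real \<times> real"
  have cb: "cball (m p) (r p) = {fst p..snd p}" for p
    by (auto simp: cball_eq_atLeastAtMost m_def r_def field_simps)
  have ex: "\<exists>p. p \<in> K \<and> t \<in> cball (m p) (r p) \<and> r p < d" if td: "t \<in> E" "d > 0" for t d
  proof -
    obtain x y where "a \<le> x \<and> x < y \<and> y \<le> b \<and> x \<le> t \<and> t \<le> y \<and> y - x < d \<and> c * (y - x) \<le> F y - F x"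
      using steep[OF td] by blast
    then show ?thesis
      unfolding cb by (intro exI[of _ "(x, y)"]) (auto simp: K_def r_def)
  qed
  have r: "0 < r p" if "p \<in> K" for p
    using that by (auto simp: K_def r_def)
  obtain C where C: "countable C" "C \<subseteq> K"
      "pairwise (\<lambda>p q. disjnt (cball (m p) (r p)) (cball (m q) (r q))) C"
      "negligible (E - (\<Union>p\<in>C. cball (m p) (r p)))"
    by (rule Vitali_covering_theorem_cballs[of K r E m, OF r ex])
  \<comment> \<open>A bound that is uniform over finite subfamilies passes to the countable
    union.\<close>
  have bound: "measure lebesgue (\<Union>p\<in>C'. cball (m p) (r p)) \<le> (F b - F a) / c"
    if C': "C' \<subseteq> C" "finite C'" for C'
  proof -
    have "measure lebesgue (\<Union>p\<in>C'. cball (m p) (r p)) \<le> (\<Sum>p\<in>C'. measure lebesgue (cball (m p) (r p)))"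
      using \<open>finite C'\<close> by (intro measure_UNION_le) auto
    also have "\<dots> \<le> (\<Sum>p\<in>C'. (F (snd p) - F (fst p)) / c)"
    proof (intro sum_mono)
      fix p assume "p \<in> C'"
      then have "p \<in> K" using C' C by blast
      then show "measure lebesgue (cball (m p) (r p)) \<le> (F (snd p) - F (fst p)) / c"
        unfolding cb using \<open>c > 0\<close> by (auto simp: K_def field_simps)
    qed
    also have "\<dots> = (\<Sum>p\<in>C'. F (snd p) - F (fst p)) / c"
      by (simp add: sum_divide_distrib)
    also have "\<dots> \<le> (F b - F a) / c"
    proof (intro divide_right_mono sum_increments_disjoint_intervals_le)
      show "pairwise (\<lambda>p q. disjnt {fst p..snd p} {fst q..snd q}) C'"
        using pairwise_subset[OF C(3) C'(1)] by (simp add: cb)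
      fix p assume "p \<in> C'"
      then have "p \<in> K" using C' C by blast
      then show "a \<le> fst p \<and> fst p \<le> snd p \<and> snd p \<le> b"
        by (auto simp: K_def)
    qed (use C' mono \<open>a \<le> b\<close> \<open>c > 0\<close> in auto)
    finally show ?thesis .
  qed
  let ?W = "\<Union>p\<in>C. cball (m p) (r p)"
  have W: "?W \<in> lmeasurable" "measure lebesgue ?W \<le> (F b - F a) / c"
    using fmeasurable_UN_bound[OF \<open>countable C\<close> _ bound] measure_UN_bound[OF \<open>countable C\<close> _ bound]
    by auto
  show thesis
  proof (rule that)
    show "?W \<union> (E - ?W) \<in> lmeasurable"
      using W C(4) by (intro fmeasurable.Un) (auto simp: negligible_imp_measurable)
    have "measure lebesgue (?W \<union> (E - ?W)) \<le> measure lebesgue ?W + measure lebesgue (E - ?W)"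
      using W C(4) by (intro measure_Un_le) (auto simp: negligible_imp_sets)
    then show "measure lebesgue (?W \<union> (E - ?W)) \<le> (F b - F a) / c"
      using W C(4) by (simp add: negligible_imp_measure0)
  qed auto
qed

lemma slope_ends:
  fixes w :: "real \<Rightarrow> real"
  assumes "s \<noteq> t"
  shows "\<exists>x y. x < y \<and> (x = s \<and> y = t \<or> x = t \<and> y = s) \<and> y - x = \<bar>s - t\<bar> \<and>
    (w s - w t) / (s - t) = (w y - w x) / (y - x)"
proof (cases "s < t")
  case True
  then show ?thesis by (intro exI[of _ s] exI[of _ t]) (simp add: field_simps)
next
  case False
  then show ?thesis using assms by (intro exI[of _ t] exI[of _ s]) auto
qed

text \<open>A slope of \<open>w\<close> of absolute value at least \<open>N\<close> forces the
  variation to be as steep on the same interval. The set thus has outer measure at most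
  \<open>(T b - T a) / N\<close> for each \<open>N > 0\<close>.\<close>

lemma negligible_unbounded_slopes:
  fixes w :: "real \<Rightarrow> real"
  assumes ac: "abs_continuous_curve a b w" and "a \<le> b"
  shows "negligible {t \<in> {a<..<b}. \<forall>N. \<exists>\<^sub>F s in at t. N \<le> \<bar>(w s - w t) / (s - t)\<bar>}" (is "negligible ?E")
  unfolding negligible_outer_le
proof (intro allI impI)
  fix e :: real assume "e > 0"
  define T where "T = variation w a"
  have inc: "\<bar>w y - w x\<bar> \<le> T y - T x" if "a \<le> x" "x \<le> y" "y \<le> b" for x y
    using variation_increment[OF ac that] by (simp add: T_def)
  \<comment> \<open>Chosen to make \<open>(T b - T a) / N\<close> at most \<open>e\<close>; the
    added 1 keeps \<open>N\<close> positive when the variation vanishes.\<close>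
  define N where "N = (T b - T a) / e + 1"
  have "T a \<le> T b" using inc[of a b] \<open>a \<le> b\<close> by simp
  then have "N > 0" using \<open>e > 0\<close> by (simp add: N_def add_nonneg_pos)
  obtain U where U: "U \<in> lmeasurable" "?E \<subseteq> U" "measure lebesgue U \<le> (T b - T a) / N"
  proof (rule mono_steep_set_outer_measure[of a b T N ?E])
    show "T x \<le> T y" if "a \<le> x" "x \<le> y" "y \<le> b" for x y
      using inc[OF that] by simp
    fix t d :: real assume t: "t \<in> ?E" and "d > 0"
    define d' where "d' = min d (min (t - a) (b - t))"
    have "d' > 0" using t \<open>d > 0\<close> by (auto simp: d'_def)
    have "\<exists>\<^sub>F s in at t. N \<le> \<bar>(w s - w t) / (s - t)\<bar>" using t by blast
    then obtain s where s: "N \<le> \<bar>(w s - w t) / (s - t)\<bar>" "dist s t < d'" "s \<noteq> t"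
      using \<open>d' > 0\<close> unfolding frequently_at by blast
    obtain x y where xy: "x < y" "x = s \<and> y = t \<or> x = t \<and> y = s" "y - x = \<bar>s - t\<bar>"
        "(w s - w t) / (s - t) = (w y - w x) / (y - x)"
      using slope_ends[OF s(3), of w] by blast
    have ends: "a \<le> x" "y \<le> b" "x \<le> t" "t \<le> y" "y - x < d"
      using s(2) xy(1,2) t unfolding d'_def dist_real_def by (simp, linarith)+
    have "N * (y - x) \<le> \<bar>w y - w x\<bar>"
      using s(1) xy by (simp add: xy(4) field_simps)
    also have "\<dots> \<le> T y - T x" using inc xy ends by simp
    finally show "\<exists>x y. a \<le> x \<and> x < y \<and> y \<le> b \<and> x \<le> t \<and> t \<le> y \<and> y - x < d \<and> N * (y - x) \<le> T y - T x"
      using ends xy(1) by blast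
  qed (use \<open>a \<le> b\<close> \<open>N > 0\<close> in auto)
  have "(T b - T a) / N \<le> e"
    using \<open>N > 0\<close> \<open>e > 0\<close> by (simp add: N_def field_simps)
  with U show "\<exists>U. ?E \<subseteq> U \<and> U \<in> lmeasurable \<and> measure lebesgue U \<le> e"
    by (meson order_trans)
qed

lemma mono_sequence_covers_interval:
  fixes x :: "nat \<Rightarrow> real"
  assumes "x 0 < t" "t \<le> x n"
  shows "\<exists>i<n. x i < t \<and> t \<le> x (Suc i)"
  using assms(2)
proof (induction n)
  case 0
  then show ?case using assms(1) by simp
next
  case (Suc n)
  then show ?case by (metis less_Suc_eq not_le)
qed

text \<open>On every piece of a nearly optimal partition, one of \<open>T - w\<close> and \<open>T + w\<close> (\<open>T\<close> the variation)
  grows little, but it is steep near each point of the exceptional set.\<close>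

lemma negligible_oscillating_slopes:
  fixes w :: "real \<Rightarrow> real"
  assumes ac: "abs_continuous_curve a b w" and "a \<le> b" "c > 0"
  shows "negligible {t \<in> {a<..<b}. (\<exists>\<^sub>F s in at t. c \<le> (w s - w t) / (s - t)) \<and>
      (\<exists>\<^sub>F s in at t. (w s - w t) / (s - t) \<le> - c)}" (is "negligible ?E")
  unfolding negligible_outer_le
proof (intro allI impI)
  fix e :: real assume "e > 0"
  define T where "T = variation w a"
  have inc: "\<bar>w y - w x\<bar> \<le> T y - T x" if "a \<le> x" "x \<le> y" "y \<le> b" for x y
    using variation_increment[OF ac that] by (simp add: T_def)
  have bdd: "bdd_above (variation_sums w a t)" if "a \<le> t" "t \<le> b" for t
    using ac that abs_continuous_curve_subinterval abs_continuous_curve_imp_bdd_above_variation_sums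
    by (metis order_refl)
  have "T a \<ge> 0"
    unfolding T_def variation_def
    using cSup_upper[OF variation_sums_nonempty[of a a w] bdd[of a]] \<open>a \<le> b\<close> by simp
  \<comment> \<open>The partition may fall short of the variation by less than \<open>e * c\<close>,
    because the exceptional part of a piece has measure at most the shortfall on that piece divided
    by \<open>c\<close>.\<close>
  have "T b - e * c < T b" using \<open>e > 0\<close> \<open>c > 0\<close> by simp
  then obtain V where "V \<in> variation_sums w a b" "T b - e * c < V"
    unfolding T_def variation_def using variation_sums_nonempty[OF \<open>a \<le> b\<close>, of w]
    by (metis less_cSupD empty_iff)
  then obtain x n where x: "mono x" "x 0 = a" "x n = b"
      and Vx: "T b - e * c < (\<Sum>i<n. norm (w (x (Suc i)) - w (x i)))"
    unfolding variation_sums_def by blast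
  have xab: "a \<le> x i" "x i \<le> x (Suc i)" "x (Suc i) \<le> b" if "i < n" for i
    using monoD[OF x(1), of 0 i] monoD[OF x(1), of i "Suc i"] monoD[OF x(1), of "Suc i" n] x that by auto
  define B where "B i = (T (x (Suc i)) - T (x i) - \<bar>w (x (Suc i)) - w (x i)\<bar>) / c" for i
  have "\<exists>U. U \<in> lmeasurable \<and> ?E \<inter> {x i<..<x (Suc i)} \<subseteq> U \<and> measure lebesgue U \<le> B i" if "i < n" for i
  proof -
    define \<theta> :: real where "\<theta> = (if w (x i) \<le> w (x (Suc i)) then 1 else -1)"
    define F where "F = (\<lambda>t. T t - \<theta> * w t)"
    have \<theta>: "\<theta> = 1 \<or> \<theta> = -1" "\<theta> * (w (x (Suc i)) - w (x i)) = \<bar>w (x (Suc i)) - w (x i)\<bar>"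
      by (auto simp: \<theta>_def)
    obtain U where U: "U \<in> lmeasurable" "?E \<inter> {x i<..<x (Suc i)} \<subseteq> U"
        "measure lebesgue U \<le> (F (x (Suc i)) - F (x i)) / c"
    proof (rule mono_steep_set_outer_measure[of "x i" "x (Suc i)" F c "?E \<inter> {x i<..<x (Suc i)}"])
      show "F s \<le> F t" if "x i \<le> s" "s \<le> t" "t \<le> x (Suc i)" for s t
        using inc[of s t] that xab[OF \<open>i < n\<close>] \<theta>(1) by (auto simp: F_def)
      fix t d :: real assume t: "t \<in> ?E \<inter> {x i<..<x (Suc i)}" and "d > 0"
      define d' where "d' = min d (min (t - x i) (x (Suc i) - t))"
      have "d' > 0" using t \<open>d > 0\<close> by (auto simp: d'_def)
      have "\<exists>\<^sub>F s in at t. \<theta> * ((w s - w t) / (s - t)) \<le> - c"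
      \<comment> \<open>The sign \<theta> is dictated by the piece, not by \<open>t\<close>. Points
        of the exceptional set see slopes of both signs, so the sign required is always
        available.\<close>
      proof (cases "\<theta> = 1")
        case True
        then show ?thesis using t by simp
      next
        case False
        then have "\<theta> = -1" using \<theta>(1) by simp
        have "\<exists>\<^sub>F s in at t. c \<le> (w s - w t) / (s - t)" using t by blast
        then show ?thesis
          by (rule frequently_elim1) (simp only: \<open>\<theta> = -1\<close> mult_minus1 neg_le_iff_le)
      qed
      then obtain s where s: "\<theta> * ((w s - w t) / (s - t)) \<le> - c" "dist s t < d'" "s \<noteq> t"
        using \<open>d' > 0\<close> unfolding frequently_at by blast
      obtain y z where yz: "y < z" "y = s \<and> z = t \<or> y = t \<and> z = s" "z - y = \<bar>s - t\<bar>"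
          "(w s - w t) / (s - t) = (w z - w y) / (z - y)"
        using slope_ends[OF s(3), of w] by blast
      have ends: "x i \<le> y" "z \<le> x (Suc i)" "y \<le> t" "t \<le> z" "z - y < d"
        using s(2) yz(1,2) t unfolding d'_def dist_real_def by (simp, linarith)+
      have "\<theta> * (w z - w y) \<le> - c * (z - y)"
        using s(1) yz(1) by (simp add: yz(4) field_simps)
      moreover have "T y \<le> T z"
        using inc[of y z] ends xab[OF \<open>i < n\<close>] yz(1) by simp
      ultimately have "c * (z - y) \<le> F z - F y"
        by (simp add: F_def algebra_simps)
      then show "\<exists>y z. x i \<le> y \<and> y < z \<and> z \<le> x (Suc i) \<and> y \<le> t \<and> t \<le> z \<and> z - y < d \<and> c * (z - y) \<le> F z - F y"
        using ends yz(1) by blast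
    qed (use xab[OF \<open>i < n\<close>] \<open>c > 0\<close> in auto)
    moreover have "(F (x (Suc i)) - F (x i)) / c = B i"
      using \<theta>(2) by (simp add: F_def B_def algebra_simps)
    ultimately show ?thesis by auto
  qed
  then have "\<forall>i\<in>{..<n}. \<exists>U. U \<in> lmeasurable \<and> ?E \<inter> {x i<..<x (Suc i)} \<subseteq> U \<and> measure lebesgue U \<le> B i"
    by blast
  from bchoice[OF this] obtain U where
    "\<forall>i\<in>{..<n}. U i \<in> lmeasurable \<and> ?E \<inter> {x i<..<x (Suc i)} \<subseteq> U i \<and> measure lebesgue (U i) \<le> B i"
    by blast
  then have U: "\<And>i. i < n \<Longrightarrow> U i \<in> lmeasurable"
      "\<And>i. i < n \<Longrightarrow> ?E \<inter> {x i<..<x (Suc i)} \<subseteq> U i" "\<And>i. i < n \<Longrightarrow> measure lebesgue (U i) \<le> B i"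
    by blast+
  let ?U = "(\<Union>i<n. U i) \<union> x ` {..n}"
  have neg: "negligible (x ` {..n})" by (simp add: negligible_finite)
  have sub: "?E \<subseteq> ?U"
  proof
    fix t assume t: "t \<in> ?E"
    then obtain i where "i < n" "x i < t" "t \<le> x (Suc i)"
      using mono_sequence_covers_interval[of x t n] x by auto
    then show "t \<in> ?U"
      using U(2)[of i] t by (cases "t = x (Suc i)") auto
  qed
  have meas: "?U \<in> lmeasurable"
    using U(1) neg by (intro fmeasurable.Un fmeasurable.finite_UN) (auto simp: negligible_imp_measurable)
  have "measure lebesgue ?U \<le> measure lebesgue (\<Union>i<n. U i) + measure lebesgue (x ` {..n})"
    using U(1) neg by (intro measure_Un_le sets.finite_UN) (auto simp: negligible_imp_sets)
  also have "\<dots> \<le> (\<Sum>i<n. measure lebesgue (U i))"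
    using U(1) neg by (auto simp: negligible_imp_measure0 intro!: measure_UNION_le)
  also have "\<dots> \<le> (\<Sum>i<n. B i)"
    using U(3) by (intro sum_mono) auto
  also have "\<dots> = (T b - T a - (\<Sum>i<n. norm (w (x (Suc i)) - w (x i)))) / c"
    using sum_lessThan_telescope[of "\<lambda>i. T (x i)" n] x
    by (simp add: B_def sum_divide_distrib[symmetric] sum_subtractf)
  also have "\<dots> \<le> e"
    using Vx \<open>T a \<ge> 0\<close> \<open>c > 0\<close> by (simp add: field_simps)
  finally show "\<exists>U. ?E \<subseteq> U \<and> U \<in> lmeasurable \<and> measure lebesgue U \<le> e"
    using sub meas by blast
qed

text \<open>Subtracting the linear function whose slope is the midpoint of \<open>p\<close> and
  \<open>q\<close> turns the gap into slopes beyond \<open>(q - p) / 2\<close> and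
  \<open>- (q - p) / 2\<close>, the case of oscillating slopes.\<close>

lemma negligible_slope_gap:
  fixes w :: "real \<Rightarrow> real"
  assumes ac: "abs_continuous_curve a b w" and "a \<le> b" "p < q"
  shows "negligible {t \<in> {a<..<b}. (\<exists>\<^sub>F s in at t. q \<le> (w s - w t) / (s - t)) \<and>
      (\<exists>\<^sub>F s in at t. (w s - w t) / (s - t) \<le> p)}" (is "negligible ?E")
proof -
  define \<gamma> where "\<gamma> = (p + q) / 2"
  define v where "v = (\<lambda>t. w t - \<gamma> * t)"
  have "abs_continuous_curve a b v"
  proof (rule abs_continuous_curve_dominated[OF ac])
    fix s t :: real assume "s \<le> t"
    have "v t - v s = (w t - w s) - \<gamma> * (t - s)"
      by (simp add: v_def algebra_simps)
    then have "norm (v t - v s) \<le> norm (w t - w s) + norm (\<gamma> * (t - s))"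
      by (metis norm_triangle_ineq4)
    then show "norm (v t - v s) \<le> 1 * norm (w t - w s) + \<bar>\<gamma>\<bar> * (t - s)"
      using \<open>s \<le> t\<close> by (simp add: abs_mult)
  qed
  then have osc: "negligible {t \<in> {a<..<b}. (\<exists>\<^sub>F s in at t. (q - p) / 2 \<le> (v s - v t) / (s - t)) \<and>
      (\<exists>\<^sub>F s in at t. (v s - v t) / (s - t) \<le> - ((q - p) / 2))}"
    using assms by (intro negligible_oscillating_slopes) auto
  have slope: "(v s - v t) / (s - t) = (w s - w t) / (s - t) - \<gamma>" if "s \<noteq> t" for s t
    using that by (simp add: v_def field_simps)
  have ne: "\<forall>\<^sub>F s in at t. s \<noteq> t" for t :: real
    by (simp add: eventually_at_filter)
  have arith: "q \<le> X \<Longrightarrow> (q - p) / 2 \<le> X - \<gamma>" "X \<le> p \<Longrightarrow> X - \<gamma> \<le> - ((q - p) / 2)" for X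
    by (auto simp: \<gamma>_def field_simps)
  have up: "\<forall>\<^sub>F s in at t. q \<le> (w s - w t) / (s - t) \<longrightarrow> (q - p) / 2 \<le> (v s - v t) / (s - t)" for t
  proof (rule eventually_mono[OF ne[of t]], intro impI)
    fix s assume "s \<noteq> t" "q \<le> (w s - w t) / (s - t)"
    then show "(q - p) / 2 \<le> (v s - v t) / (s - t)"
      unfolding slope[OF \<open>s \<noteq> t\<close>] by (intro arith(1))
  qed
  have dn: "\<forall>\<^sub>F s in at t. (w s - w t) / (s - t) \<le> p \<longrightarrow> (v s - v t) / (s - t) \<le> - ((q - p) / 2)" for t
  proof (rule eventually_mono[OF ne[of t]], intro impI)
    fix s assume "s \<noteq> t" "(w s - w t) / (s - t) \<le> p"
    then show "(v s - v t) / (s - t) \<le> - ((q - p) / 2)"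
      unfolding slope[OF \<open>s \<noteq> t\<close>] by (intro arith(2))
  qed
  show ?thesis
    by (rule negligible_subset[OF osc]) (use frequently_mp[OF up] frequently_mp[OF dn] in blast)
qed

text \<open>If the difference quotient has no limit in the extended reals, two rationals separate
  its lower from its upper limit, and there are only countably many rational pairs. If the limit
  exists but is infinite, the slopes are unbounded.\<close>

lemma abs_continuous_curve_real_differentiable_ae:
  fixes w :: "real \<Rightarrow> real"
  assumes ac: "abs_continuous_curve a b w" and "a \<le> b"
  shows "negligible {t \<in> {a<..<b}. \<not> w differentiable at t}"
proof (rule negligible_subset)
  let ?E = "\<lambda>p q. {t \<in> {a<..<b}. (\<exists>\<^sub>F s in at t. q \<le> (w s - w t) / (s - t)) \<and>
      (\<exists>\<^sub>F s in at t. (w s - w t) / (s - t) \<le> p)}"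
  let ?I = "{t \<in> {a<..<b}. \<forall>N. \<exists>\<^sub>F s in at t. N \<le> \<bar>(w s - w t) / (s - t)\<bar>}"
  let ?G = "\<Union>(p, q)\<in>{(p, q) \<in> \<rat> \<times> \<rat>. p < q}. ?E p q"
  have "countable {(p, q) \<in> \<rat> \<times> (\<rat> :: real set). p < q}"
    by (rule countable_subset[of _ "\<rat> \<times> \<rat>"]) (auto simp: countable_rat)
  then have "negligible ?G"
    using negligible_slope_gap[OF assms] by (intro negligible_countable_Union) auto
  then show "negligible (?I \<union> ?G)"
    using negligible_unbounded_slopes[OF assms] by (intro negligible_Un)
  show "{t \<in> {a<..<b}. \<not> w differentiable at t} \<subseteq> ?I \<union> ?G"
  proof safe
    fix t assume t: "t \<in> {a<..<b}" "\<not> w differentiable at t" "t \<notin> ?G"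
    define \<phi> where "\<phi> = (\<lambda>s. (w s - w t) / (s - t))"
    have "Liminf (at t) (\<lambda>s. ereal (\<phi> s)) \<ge> Limsup (at t) (\<lambda>s. ereal (\<phi> s))"
    proof (rule ccontr)
      assume "\<not> ?thesis"
      then have "Liminf (at t) (\<lambda>s. ereal (\<phi> s)) < Limsup (at t) (\<lambda>s. ereal (\<phi> s))" by simp
      then obtain q where q: "Liminf (at t) (\<lambda>s. ereal (\<phi> s)) < ereal (real_of_rat q)"
          "ereal (real_of_rat q) < Limsup (at t) (\<lambda>s. ereal (\<phi> s))"
        using ereal_dense3 by blast
      then obtain p where p: "Liminf (at t) (\<lambda>s. ereal (\<phi> s)) < ereal (real_of_rat p)"
          "ereal (real_of_rat p) < ereal (real_of_rat q)"
        using ereal_dense3 by blast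
      have "\<exists>\<^sub>F s in at t. real_of_rat q \<le> \<phi> s"
      proof (rule ccontr)
        assume "\<not> ?thesis"
        then have "\<forall>\<^sub>F s in at t. ereal (\<phi> s) \<le> ereal (real_of_rat q)"
          unfolding not_frequently by (rule eventually_mono) auto
        from Limsup_bounded[OF this] q(2) show False by simp
      qed
      moreover have "\<exists>\<^sub>F s in at t. \<phi> s \<le> real_of_rat p"
      proof (rule ccontr)
        assume "\<not> ?thesis"
        then have "\<forall>\<^sub>F s in at t. ereal (real_of_rat p) \<le> ereal (\<phi> s)"
          unfolding not_frequently by (rule eventually_mono) auto
        from Liminf_bounded[OF this] p(1) show False by simp
      qed
      ultimately have "t \<in> ?E (real_of_rat p) (real_of_rat q)"
        using t(1) by (simp add: \<phi>_def)
      moreover have "(real_of_rat p, real_of_rat q) \<in> {(p, q) \<in> \<rat> \<times> \<rat>. p < q}"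
        using p(2) by simp
      ultimately show False using t(3) by blast
    qed
    then have "Limsup (at t) (\<lambda>s. ereal (\<phi> s)) = Liminf (at t) (\<lambda>s. ereal (\<phi> s))"
      by (simp add: Liminf_le_Limsup antisym)
    then have lim: "((\<lambda>s. ereal (\<phi> s)) \<longlongrightarrow> Liminf (at t) (\<lambda>s. ereal (\<phi> s))) (at t)"
      by (subst tendsto_iff_Liminf_eq_Limsup) auto
    show "\<exists>\<^sub>F s in at t. N \<le> \<bar>(w s - w t) / (s - t)\<bar>" for N
    proof (cases "Liminf (at t) (\<lambda>s. ereal (\<phi> s))")
      case (real l)
      then have "(\<phi> \<longlongrightarrow> l) (at t)" using lim by simp
      then have "(w has_field_derivative l) (at t)"
        unfolding \<phi>_def by (simp add: has_field_derivative_iff)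
      then show ?thesis
        using t(2) real_differentiable_def by blast
    next
      case PInf
      then have "\<forall>\<^sub>F s in at t. ereal N < ereal (\<phi> s)"
        using lim by (auto simp: tendsto_PInfty)
      then have "\<forall>\<^sub>F s in at t. N \<le> \<bar>\<phi> s\<bar>"
        by (rule eventually_mono) auto
      then have "\<forall>\<^sub>F s in at t. N \<le> \<bar>(w s - w t) / (s - t)\<bar>"
        unfolding \<phi>_def .
      then show ?thesis by (rule eventually_frequently[rotated]) simp
    next
      case MInf
      then have "\<forall>\<^sub>F s in at t. ereal (\<phi> s) < ereal (- N)"
        using lim by (auto simp: tendsto_MInfty)
      then have "\<forall>\<^sub>F s in at t. N \<le> \<bar>\<phi> s\<bar>"
        by (rule eventually_mono) auto
      then have "\<forall>\<^sub>F s in at t. N \<le> \<bar>(w s - w t) / (s - t)\<bar>"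
        unfolding \<phi>_def .
      then show ?thesis by (rule eventually_frequently[rotated]) simp
    qed
  qed
qed

theorem abs_continuous_curve_differentiable_ae:
  fixes \<sigma> :: "real \<Rightarrow> 'a::euclidean_space"
  assumes ac: "abs_continuous_curve a b \<sigma>" and "a \<le> b"
  shows "negligible {t \<in> {a<..<b}. \<not> \<sigma> differentiable at t}"
proof (rule negligible_subset)
  have "abs_continuous_curve a b (\<lambda>t. \<sigma> t \<bullet> i)" if "i \<in> Basis" for i
  proof (rule abs_continuous_curve_dominated[OF ac])
    show "norm (\<sigma> t \<bullet> i - \<sigma> s \<bullet> i) \<le> 1 * norm (\<sigma> t - \<sigma> s) + 0 * (t - s)" for s t
      using Basis_le_norm[OF that, of "\<sigma> t - \<sigma> s"] by (simp add: inner_diff_left)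
  qed
  then show "negligible (\<Union>i\<in>Basis. {t \<in> {a<..<b}. \<not> (\<lambda>t. \<sigma> t \<bullet> i) differentiable at t})"
    using abs_continuous_curve_real_differentiable_ae[OF _ \<open>a \<le> b\<close>]
    by (intro negligible_Union) (auto simp del: greaterThanLessThan_iff)
  show "{t \<in> {a<..<b}. \<not> \<sigma> differentiable at t}
      \<subseteq> (\<Union>i\<in>Basis. {t \<in> {a<..<b}. \<not> (\<lambda>t. \<sigma> t \<bullet> i) differentiable at t})"
    using differentiable_componentwise_within[of \<sigma> _ UNIV] by auto
qed

section \<open>Comparing an increment with the integral of the derivative\<close>

lemma borel_measurable_abs_deriv:
  fixes w :: "real \<Rightarrow> real"
  assumes "continuous_on {a..b} w" "a \<le> b" "S \<in> sets lebesgue" "S \<subseteq> {a<..<b}"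
    and D: "\<And>t. t \<in> S \<Longrightarrow> (w has_real_derivative D t) (at t)"
  shows "(\<lambda>t. indicator S t * \<bar>D t\<bar>) \<in> borel_measurable lebesgue"
proof (rule borel_measurable_LIMSEQ_real)
  \<comment> \<open>The extension of \<open>w\<close> by constants is continuous on the whole line,
    so the quotients at \<open>t + 1 / real (Suc n)\<close> are defined and measurable even where
    that point exceeds \<open>b\<close>.\<close>
  define W where "W t = w (max a (min b t))" for t
  have "continuous_on UNIV W"
    unfolding W_def
    by (rule continuous_on_compose2[OF assms(1)]) (use \<open>a \<le> b\<close> in \<open>auto intro!: continuous_intros\<close>)
  note W = this
  have "continuous_on UNIV (\<lambda>t. W (t + c))" for c
    by (rule continuous_on_compose2[OF W]) (auto intro!: continuous_intros)
  then have cW: "continuous_on UNIV (\<lambda>t. \<bar>real (Suc n) * (W (t + 1 / real (Suc n)) - W t)\<bar>)" for n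
    by (intro continuous_on_rabs continuous_on_mult continuous_on_const continuous_on_diff W)
  have "(\<lambda>t. \<bar>real (Suc n) * (W (t + 1 / real (Suc n)) - W t)\<bar>) \<in> borel_measurable lborel" for n
    using borel_measurable_continuous_onI[OF cW[of n]] by simp
  then show "(\<lambda>t. indicator S t * \<bar>real (Suc n) * (W (t + 1 / real (Suc n)) - W t)\<bar>) \<in> borel_measurable lebesgue" for n
    by (intro borel_measurable_times borel_measurable_indicator assms(3) measurable_completion)
  fix t
  show "(\<lambda>n. indicator S t * \<bar>real (Suc n) * (W (t + 1 / real (Suc n)) - W t)\<bar>)
      \<longlonglongrightarrow> indicator S t * \<bar>D t\<bar>"
  proof (cases "t \<in> S")
    case True
    then have t: "a < t" "t < b" using assms by auto
    have "(W has_real_derivative D t) (at t)"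
    proof (rule has_field_derivative_transform_within_open[OF D[OF True]])
      show "\<And>x. x \<in> {a<..<b} \<Longrightarrow> w x = W x" by (simp add: W_def)
    qed (use t in auto)
    then have "((\<lambda>h. (W (t + h) - W t) / h) \<longlongrightarrow> D t) (at 0)"
      by (simp add: DERIV_def)
    moreover have "filterlim (\<lambda>n. 1 / real (Suc n)) (at 0) sequentially"
      unfolding filterlim_at using LIMSEQ_inverse_real_of_nat by (simp add: inverse_eq_divide)
    ultimately have "(\<lambda>n. (W (t + 1 / real (Suc n)) - W t) / (1 / real (Suc n))) \<longlonglongrightarrow> D t"
      by (rule filterlim_compose)
    then have "(\<lambda>n. real (Suc n) * (W (t + 1 / real (Suc n)) - W t)) \<longlonglongrightarrow> D t"
      by (simp add: field_simps)
    then show ?thesis using True by (auto intro!: tendsto_rabs)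
  qed simp
qed


text \<open>Off the null set \<open>N\<close> a sufficiently fine tagged division compares increments with \<open>H\<close>; the
  pieces tagged in \<open>N\<close> lie in an open set of small measure, so absolute continuity controls them.\<close>

theorem abs_continuous_curve_increment_le_nn_integral:
  fixes w :: "real \<Rightarrow> real" and H :: "real \<Rightarrow> ennreal"
  assumes ac: "abs_continuous_curve a b w" and "a \<le> b" and negN: "negligible N"
    and H: "\<And>t. t \<in> {a<..<b} - N \<Longrightarrow> \<exists>D. (w has_real_derivative D) (at t) \<and> ennreal \<bar>D\<bar> \<le> H t"
  shows "ennreal \<bar>w b - w a\<bar> \<le> (\<integral>\<^sup>+ t\<in>{a..b}. H t \<partial>lebesgue)"
proof -
  define S where "S = {a<..<b} - N"
  \<comment> \<open>The endpoints can occur as tags, yet no derivative is assumed there; they are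
    treated like points of \<open>N\<close>.\<close>
  define N' where "N' = N \<union> {a, b}"
  have SN': "{a..b} \<subseteq> S \<union> N'" "S \<inter> N' = {}" by (auto simp: S_def N'_def)
  have negN': "negligible N'" using negN by (auto simp: N'_def negligible_Un negligible_finite)
  have S_meas: "S \<in> sets lebesgue"
    unfolding S_def using negligible_imp_sets[OF negN] by (intro sets.Diff) auto
  obtain D where D: "\<And>t. t \<in> S \<Longrightarrow> (w has_real_derivative D t) (at t)" "\<And>t. t \<in> S \<Longrightarrow> ennreal \<bar>D t\<bar> \<le> H t"
    using H unfolding S_def by metis
  \<comment> \<open>The function \<open>H\<close> may fail to be measurable. The measurable minorant
    \<open>h\<close> carries the argument, and monotonicity of the integral, valid without
    measurability, passes to \<open>H\<close> at the end.\<close>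
  define h where "h t = indicator S t * \<bar>D t\<bar>" for t
  have h0: "h t \<ge> 0" for t by (simp add: h_def)
  have h_meas: "h \<in> borel_measurable lebesgue"
    unfolding h_def
    by (rule borel_measurable_abs_deriv[OF abs_continuous_curve_imp_continuous_on[OF ac] \<open>a \<le> b\<close> S_meas _ D(1)])
      (auto simp: S_def)
  have "ennreal \<bar>w b - w a\<bar> \<le> (\<integral>\<^sup>+ t. ennreal (h t) \<partial>lebesgue)"
  proof (cases "(\<integral>\<^sup>+ t. ennreal (h t) \<partial>lebesgue) = \<infinity>")
    case True
    then show ?thesis by simp
  next
    case False
    then have int: "integrable lebesgue h"
      using h_meas h0 by (intro integrableI_nonneg) (auto simp: top.not_eq_extremum)
    define I where "I = integral\<^sup>L lebesgue h"
    have nnI: "(\<integral>\<^sup>+ t. ennreal (h t) \<partial>lebesgue) = ennreal I"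
      unfolding I_def using int h0 by (intro nn_integral_eq_integral) auto
    have "(h has_integral I) UNIV"
      unfolding I_def using int by (rule has_integral_integral_lebesgue)
    moreover have "h = (\<lambda>t. if t \<in> cbox a b then h t else 0)"
      by (rule ext) (auto simp: h_def S_def indicator_def)
    ultimately have hI: "(h has_integral I) (cbox a b)"
      by (metis has_integral_restrict_UNIV)
    have "\<bar>w b - w a\<bar> \<le> I + e" if "e > 0" for e
    proof -
      \<comment> \<open>One \<eta> pays for the Riemann sum of \<open>h\<close>, one for the pieces
        tagged in the null set, and \<open>\<eta> * (b - a)\<close> for the linear approximations on
        the others.\<close>
      define \<eta> where "\<eta> = e / (b - a + 2)"
      have "\<eta> > 0" "\<eta> * (b - a + 2) = e" using \<open>e > 0\<close> \<open>a \<le> b\<close> by (auto simp: \<eta>_def)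
      obtain g where g: "gauge g" "\<And>p. p tagged_division_of cbox a b \<Longrightarrow> g fine p \<Longrightarrow>
          norm ((\<Sum>(x, K)\<in>p. measure lborel K *\<^sub>R h x) - I) < \<eta>"
        using hI[unfolded has_integral, rule_format, OF \<open>\<eta> > 0\<close>] by auto
      have "\<exists>d>0. \<forall>y. \<bar>y - t\<bar> < d \<longrightarrow> \<bar>w y - w t - D t * (y - t)\<bar> \<le> \<eta> * \<bar>y - t\<bar>" if "t \<in> S" for t
        using D(1)[OF that] \<open>\<eta> > 0\<close> unfolding has_field_derivative_def has_derivative_at_alt by simp
      then obtain d where d: "\<And>t. t \<in> S \<Longrightarrow> d t > 0"
          "\<And>t y. \<lbrakk>t \<in> S; \<bar>y - t\<bar> < d t\<rbrakk> \<Longrightarrow> \<bar>w y - w t - D t * (y - t)\<bar> \<le> \<eta> * \<bar>y - t\<bar>"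
        by metis
      obtain \<delta> where "\<delta> > 0" and \<delta>:
        "\<forall>P (s :: real \<times> real set \<Rightarrow> real) t. finite P \<and> (\<forall>i\<in>P. a \<le> s i \<and> s i \<le> t i \<and> t i \<le> b) \<and>
          disjoint_family_on (\<lambda>i. {s i<..<t i}) P \<and> (\<Sum>i\<in>P. t i - s i) < \<delta>
          \<longrightarrow> (\<Sum>i\<in>P. norm (w (t i) - w (s i))) < \<eta>"
        using abs_continuous_curve_finite_family[OF ac \<open>\<eta> > 0\<close>] by blast
      obtain G where G: "open G" "N' \<subseteq> G" "G \<in> lmeasurable" "measure lebesgue G < \<delta>"
      proof -
        obtain G where G: "open G" "N' \<subseteq> G" "G - N' \<in> lmeasurable" "emeasure lebesgue (G - N') < ennreal \<delta>"
          using sets_lebesgue_outer_open[OF negligible_imp_sets[OF negN'] \<open>\<delta> > 0\<close>] by blast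
        have "N' \<in> lmeasurable" using negN' by (rule negligible_imp_measurable)
        then have Gm: "G \<in> lmeasurable" using fmeasurable_Diff_D[OF G(3) _ G(2)] by blast
        have "measure lebesgue G \<le> measure lebesgue (G - N') + measure lebesgue N'"
          using measure_Un_le[of "G - N'" lebesgue N'] G negN' by (simp add: negligible_imp_sets Un_absorb2 fmeasurableD)
        also have "measure lebesgue N' = 0" using negN' by (rule negligible_imp_measure0)
        also have "measure lebesgue (G - N') < \<delta>"
          using G(3,4) \<open>\<delta> > 0\<close> by (simp add: emeasure_eq_measure2 ennreal_less_iff)
        finally show thesis using that[OF G(1,2) Gm] by simp
      qed
      \<comment> \<open>Tags in \<open>S\<close> force the range of the linear approximation, tags
        in \<open>N'\<close> force the piece into \<open>G\<close>. All other points lie outside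
        \<open>{a..b}\<close> and never serve as tags.\<close>
      define \<gamma> where "\<gamma> t = g t \<inter> (if t \<in> S then ball t (d t) else if t \<in> N' then G else UNIV)" for t
      have "gauge \<gamma>"
        using g(1) G(1,2) d(1) by (auto simp: gauge_def \<gamma>_def)
      then obtain p where p: "p tagged_division_of {a..b}" "\<gamma> fine p"
        using fine_division_exists_real by blast
      have "g fine p" using p(2) unfolding fine_def \<gamma>_def by blast
      have fine: "K \<subseteq> \<gamma> t" if "(t, K) \<in> p" for t K
        using p(2) that unfolding fine_def by blast
      have fin: "finite p" using p(1) by (rule tagged_division_of_finite)
      have piece: "\<exists>u v. K = {u..v} \<and> u \<le> t \<and> t \<le> v \<and> a \<le> u \<and> v \<le> b" if tK: "(t, K) \<in> p" for t K
      proof -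
        obtain u v where K: "K = cbox u v" using tagged_division_ofD(4)[OF p(1) tK] by blast
        moreover have "t \<in> K" "K \<subseteq> {a..b}" using tagged_division_ofD(2,3)[OF p(1) tK] by auto
        ultimately have "u \<le> t" "t \<le> v" "u \<in> {a..b}" "v \<in> {a..b}" by auto
        then show ?thesis using K by auto
      qed
      have good: "\<bar>w (Sup K) - w (Inf K)\<bar> \<le> (h t + \<eta>) * measure lborel K" if tK: "(t, K) \<in> p" "t \<in> S" for t K
      proof -
        obtain u v where K: "K = {u..v}" "u \<le> t" "t \<le> v" using piece[OF tK(1)] by blast
        have "K \<subseteq> ball t (d t)" using fine[OF tK(1)] tK(2) unfolding \<gamma>_def by simp
        moreover have "u \<in> K" "v \<in> K" using K by auto
        ultimately have "u \<in> ball t (d t)" "v \<in> ball t (d t)" by blast+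
        then have "\<bar>u - t\<bar> < d t" "\<bar>v - t\<bar> < d t" by (auto simp: dist_real_def)
        then have "\<bar>w u - w t - D t * (u - t)\<bar> \<le> \<eta> * (t - u)" "\<bar>w v - w t - D t * (v - t)\<bar> \<le> \<eta> * (v - t)"
          using d(2)[OF tK(2), of u] d(2)[OF tK(2), of v] K by auto
        \<comment> \<open>The tag lies between the ends of its piece, so the two approximation
          errors add up to \<eta> times the length.\<close>
        moreover have "w v - w u = (w v - w t - D t * (v - t)) - (w u - w t - D t * (u - t)) + D t * (v - u)"
          by (simp add: algebra_simps)
        ultimately have "\<bar>w v - w u\<bar> \<le> \<eta> * (v - t) + \<eta> * (t - u) + \<bar>D t * (v - u)\<bar>" by linarith
        also have "\<bar>D t * (v - u)\<bar> = h t * (v - u)"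
          using K tK(2) by (simp add: h_def abs_mult)
        also have "\<eta> * (v - t) + \<eta> * (t - u) + h t * (v - u) = (h t + \<eta>) * (v - u)"
          by (simp add: algebra_simps)
        finally show ?thesis using K by simp
      qed
      let ?A = "{z \<in> p. fst z \<in> S}"
      have bad: "(\<Sum>z\<in>p - ?A. \<bar>w (Sup (snd z)) - w (Inf (snd z))\<bar>) < \<eta>"
      proof -
        have badp: "\<exists>u v. snd z = {u..v} \<and> u \<le> v \<and> a \<le> u \<and> v \<le> b \<and> {u..v} \<subseteq> G" if "z \<in> p - ?A" for z
        proof -
          obtain t K where z: "z = (t, K)" by force
          then have "(t, K) \<in> p" "t \<notin> S" using that by auto
          moreover obtain u v where K: "K = {u..v}" "u \<le> t" "t \<le> v" "a \<le> u" "v \<le> b"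
            using piece[OF \<open>(t, K) \<in> p\<close>] by blast
          moreover have "t \<in> {a..b}" using K by auto
          ultimately have "t \<in> N'" using SN'(1) by blast
          then have "K \<subseteq> G" using fine[OF \<open>(t, K) \<in> p\<close>] \<open>t \<notin> S\<close> unfolding \<gamma>_def by simp
          then show ?thesis using K z by (intro exI[of _ u] exI[of _ v]) auto
        qed
        define lo where "lo z = Inf (snd z)" for z :: "real \<times> real set"
        define hi where "hi z = Sup (snd z)" for z :: "real \<times> real set"
        have lohi: "a \<le> lo z" "lo z \<le> hi z" "hi z \<le> b" "{lo z..hi z} \<subseteq> G" "snd z = {lo z..hi z}"
          if "z \<in> p - ?A" for z
          using badp[OF that] by (auto simp: lo_def hi_def)
        have disj: "disjoint_family_on (\<lambda>z. {lo z<..<hi z}) (p - ?A)"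
          unfolding disjoint_family_on_def
        proof (intro ballI impI)
          fix y z assume yz: "y \<in> p - ?A" "z \<in> p - ?A" "y \<noteq> z"
          have "interior (snd y) \<inter> interior (snd z) = {}"
            using tagged_division_ofD(5)[OF p(1), of "fst y" "snd y" "fst z" "snd z"] yz by auto
          then show "{lo y<..<hi y} \<inter> {lo z<..<hi z} = {}"
            using lohi(5) yz by simp
        qed
        have "(\<Sum>z\<in>p - ?A. hi z - lo z) = (\<Sum>z\<in>p - ?A. measure lebesgue {lo z<..<hi z})"
          using lohi(2) by (intro sum.cong) auto
        also have "\<dots> = measure lebesgue (\<Union>z\<in>p - ?A. {lo z<..<hi z})"
          using fin disj by (intro measure_UNION'[symmetric]) (auto simp: pairwise_def disjnt_def disjoint_family_on_def)
        also have "\<dots> \<le> measure lebesgue G"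
        proof (rule measure_mono_fmeasurable[OF _ _ G(3)])
          show "(\<Union>z\<in>p - ?A. {lo z<..<hi z}) \<subseteq> G"
          proof (rule UN_least)
            fix z assume "z \<in> p - ?A"
            then show "{lo z<..<hi z} \<subseteq> G" using lohi(4)[of z] by (auto simp: subset_iff)
          qed
          show "(\<Union>z\<in>p - ?A. {lo z<..<hi z}) \<in> sets lebesgue"
            using fin by (intro sets.finite_UN) auto
        qed
        also have "\<dots> < \<delta>" by (rule G)
        finally have "(\<Sum>z\<in>p - ?A. norm (w (hi z) - w (lo z))) < \<eta>"
          using \<delta>[rule_format, of "p - ?A" lo hi] fin lohi(1-3) disj by blast
        then show ?thesis by (simp add: lo_def hi_def)
      qed
      have "w b - w a = (\<Sum>z\<in>p. w (Sup (snd z)) - w (Inf (snd z)))"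
        using additive_tagged_division_1[OF \<open>a \<le> b\<close> p(1), of w] by (simp add: case_prod_beta)
      also have "\<bar>\<dots>\<bar> \<le> (\<Sum>z\<in>p. \<bar>w (Sup (snd z)) - w (Inf (snd z))\<bar>)" by (rule sum_abs)
      also have "\<dots> = (\<Sum>z\<in>p - ?A. \<bar>w (Sup (snd z)) - w (Inf (snd z))\<bar>) + (\<Sum>z\<in>?A. \<bar>w (Sup (snd z)) - w (Inf (snd z))\<bar>)"
        using fin by (intro sum.subset_diff) auto
      also have "\<dots> \<le> \<eta> + (\<Sum>z\<in>?A. (h (fst z) + \<eta>) * measure lborel (snd z))"
        using bad good by (intro add_mono sum_mono) auto
      also have "(\<Sum>z\<in>?A. (h (fst z) + \<eta>) * measure lborel (snd z)) \<le> (\<Sum>z\<in>p. (h (fst z) + \<eta>) * measure lborel (snd z))"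
        using fin h0 \<open>\<eta> > 0\<close> by (intro sum_mono2) (auto intro!: mult_nonneg_nonneg add_nonneg_nonneg)
      also have "\<dots> = (\<Sum>z\<in>p. measure lborel (snd z) * h (fst z)) + \<eta> * (\<Sum>z\<in>p. measure lborel (snd z))"
        by (simp add: algebra_simps sum.distrib sum_distrib_left)
      also have "(\<Sum>z\<in>p. measure lborel (snd z)) = b - a"
        using additive_content_tagged_division[of p a b] p(1) \<open>a \<le> b\<close> by (simp add: case_prod_beta)
      also have "(\<Sum>z\<in>p. measure lborel (snd z) * h (fst z)) \<le> I + \<eta>"
        using g(2)[of p] p(1) \<open>g fine p\<close> by (simp add: case_prod_beta)
      finally show ?thesis using \<open>\<eta> * (b - a + 2) = e\<close> by (simp add: algebra_simps)
    qed
    then have "\<bar>w b - w a\<bar> \<le> I" by (rule field_le_epsilon)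
    then show ?thesis unfolding nnI by (rule ennreal_leI)
  qed
  also have "\<dots> \<le> (\<integral>\<^sup>+ t\<in>{a..b}. H t \<partial>lebesgue)"
    using D(2) by (intro nn_integral_mono) (auto simp: h_def S_def indicator_def)
  finally show ?thesis .
qed

section \<open>Upper bounds for the Kobayashi distance\<close>

lemma norm_vector_scalar_mult:
  fixes v :: "complex ^ 'd"
  shows "norm (z *s v) = cmod z * norm v"
  by (simp add: norm_vec_def vector_scalar_mult_def norm_mult L2_set_right_distrib)

lemma of_real_vector_scalar_mult:
  fixes v :: "complex ^ 'd"
  shows "complex_of_real r *s v = r *\<^sub>R v"
  unfolding vec_eq_iff by simp (simp add: scaleR_conv_of_real)

lemma kobayashi_metric_le:
  assumes "holomorphic_vec f (ball 0 1)" "f ` ball 0 1 \<subseteq> \<Omega>" "f 0 = x" "\<zeta> *s deriv_vec f 0 = v"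
  shows "kobayashi_metric \<Omega> x v \<le> cmod \<zeta>"
  unfolding kobayashi_metric_def
proof (rule cInf_lower)
  show "bdd_below {cmod \<zeta> |\<zeta>. \<exists>f. holomorphic_vec f (ball 0 1) \<and> f ` ball 0 1 \<subseteq> \<Omega> \<and>
      f 0 = x \<and> \<zeta> *s deriv_vec f 0 = v}"
    by (rule bdd_belowI[of _ 0]) auto
qed (use assms in blast)

text \<open>The competitor is the automorphism \<open>z \<mapsto> (z + \<beta>) / (1 + \<beta> z)\<close> of the unit disc with
  \<open>\<beta> = (t - c) / \<rho>\<close>, followed by the affine map of the unit disc onto the disc of centre \<open>c\<close>
  and radius \<open>\<rho>\<close>.\<close>

lemma affine_disc_competitor:
  fixes p n :: "complex ^ 'd" and c \<rho> t :: real
  assumes disc: "\<And>z. cmod (z - of_real c) < \<rho> \<Longrightarrow> p + z *s n \<in> \<Omega>" and t: "\<bar>t - c\<bar> < \<rho>"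
  shows "\<exists>f. holomorphic_vec f (ball 0 1) \<and> f ` ball 0 1 \<subseteq> \<Omega> \<and> f 0 = p + t *\<^sub>R n \<and>
    of_real (\<rho> / (\<rho>\<^sup>2 - (t - c)\<^sup>2)) *s deriv_vec f 0 = n"
proof -
  define \<beta> where "\<beta> = (t - c) / \<rho>"
  have "\<rho> > 0" using t by linarith
  have \<beta>: "\<bar>\<beta>\<bar> < 1" using t \<open>\<rho> > 0\<close> by (simp add: \<beta>_def)
  then have "\<beta>\<^sup>2 < 1" by (simp add: abs_square_less_1)
  define m where "m z = (z + of_real \<beta>) / (1 + of_real \<beta> * z)" for z :: complex
  have nz: "1 + of_real \<beta> * z \<noteq> 0" if "cmod z < 1" for z
  proof
    assume "1 + of_real \<beta> * z = 0"
    then have "cmod (of_real \<beta> * z) = 1" by (metis add_eq_0_iff norm_minus_cancel norm_one)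
    moreover have "\<bar>\<beta>\<bar> * cmod z < 1" using \<beta> that mult_right_mono[of "\<bar>\<beta>\<bar>" 1 "cmod z"] by simp
    ultimately show False by (simp add: norm_mult)
  qed
  have m_lt: "cmod (m z) < 1" if "cmod z < 1" for z
  proof -
    have "m z = Moebius_function 0 (- of_real \<beta>) z" by (simp add: m_def Moebius_function_def)
    then show ?thesis using Moebius_function_norm_lt_1[of "- of_real \<beta>" z 0] \<beta> that by simp
  qed
  define k where "k z = of_real c + of_real \<rho> * m z" for z
  define f where "f z = p + k z *s n" for z
  have k_hol: "k holomorphic_on ball 0 1"
    unfolding k_def m_def by (intro holomorphic_intros) (use nz in auto)
  have f_comp: "f z $ i = p $ i + k z * n $ i" for z i
    by (simp add: f_def)
  have hol: "holomorphic_vec f (ball 0 1)"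
    unfolding holomorphic_vec_def f_comp using k_hol by (intro allI holomorphic_intros)
  have img: "f ` ball 0 1 \<subseteq> \<Omega>"
  proof safe
    fix z :: complex assume "z \<in> ball 0 1"
    then have "cmod (m z) < 1" using m_lt by simp
    then have "cmod (k z - of_real c) < \<rho>"
      using \<open>\<rho> > 0\<close> by (simp add: k_def norm_mult)
    then show "f z \<in> \<Omega>" unfolding f_def by (rule disc)
  qed
  have "k 0 = of_real t" using \<open>\<rho> > 0\<close> by (simp add: k_def m_def \<beta>_def)
  then have f0: "f 0 = p + t *\<^sub>R n" by (simp add: f_def of_real_vector_scalar_mult)
  have "(k has_field_derivative of_real (\<rho> * (1 - \<beta>\<^sup>2))) (at 0)"
    unfolding k_def m_def
    by (auto intro!: derivative_eq_intros simp: power2_eq_square algebra_simps)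
  then have "((\<lambda>z. f z $ i) has_field_derivative of_real (\<rho> * (1 - \<beta>\<^sup>2)) * n $ i) (at 0)" for i
    unfolding f_comp by (auto intro!: derivative_eq_intros)
  then have "deriv_vec f 0 = of_real (\<rho> * (1 - \<beta>\<^sup>2)) *s n"
    by (simp add: deriv_vec_def vec_eq_iff DERIV_imp_deriv)
  moreover have "\<rho> / (\<rho>\<^sup>2 - (t - c)\<^sup>2) * (\<rho> * (1 - \<beta>\<^sup>2)) = 1"
  proof -
    have "\<rho> * (\<rho> * (1 - \<beta>\<^sup>2)) = \<rho>\<^sup>2 - (t - c)\<^sup>2"
      using \<open>\<rho> > 0\<close> by (simp add: \<beta>_def power2_eq_square field_simps)
    moreover have "\<rho> * (\<rho> * (1 - \<beta>\<^sup>2)) \<noteq> 0" using \<open>\<rho> > 0\<close> \<open>\<beta>\<^sup>2 < 1\<close> by simp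
    ultimately show ?thesis by (metis divide_self times_divide_eq_left)
  qed
  ultimately have "of_real (\<rho> / (\<rho>\<^sup>2 - (t - c)\<^sup>2)) *s deriv_vec f 0 = n"
    by (simp only: vector_smult_assoc of_real_mult[symmetric] of_real_1 vector_smult_lid)
  with hol img f0 show ?thesis by blast
qed

lemma kobayashi_metric_affine_disc_le:
  fixes p n :: "complex ^ 'd" and c \<rho> t :: real
  assumes "\<And>z. cmod (z - of_real c) < \<rho> \<Longrightarrow> p + z *s n \<in> \<Omega>" "\<bar>t - c\<bar> < \<rho>"
  shows "kobayashi_metric \<Omega> (p + t *\<^sub>R n) n \<le> \<rho> / (\<rho>\<^sup>2 - (t - c)\<^sup>2)"
proof -
  obtain f where "holomorphic_vec f (ball 0 1)" "f ` ball 0 1 \<subseteq> \<Omega>" "f 0 = p + t *\<^sub>R n"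
    "of_real (\<rho> / (\<rho>\<^sup>2 - (t - c)\<^sup>2)) *s deriv_vec f 0 = n"
    using affine_disc_competitor[OF assms] by blast
  then have "kobayashi_metric \<Omega> (p + t *\<^sub>R n) n \<le> cmod (of_real (\<rho> / (\<rho>\<^sup>2 - (t - c)\<^sup>2)))"
    by (rule kobayashi_metric_le)
  moreover have "(t - c)\<^sup>2 < \<rho>\<^sup>2" using power_strict_mono[OF assms(2), of 2] by simp
  moreover have "\<rho> > 0" using assms(2) by linarith
  ultimately show ?thesis by (simp del: of_real_divide of_real_diff of_real_power)
qed

text \<open>The complex line through \<open>y\<close> in direction \<open>v\<close> meets the ball
  in a disc of parameter radius \<open>\<eta> / norm v\<close> about \<open>y\<close>. Apart from
  bounding the metric, this shows that the infimum defining it ranges over a nonempty set.\<close>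

lemma ball_competitor:
  fixes y v :: "complex ^ 'd"
  assumes "ball y \<eta> \<subseteq> \<Omega>" "\<eta> > 0"
  shows "\<exists>f. holomorphic_vec f (ball 0 1) \<and> f ` ball 0 1 \<subseteq> \<Omega> \<and> f 0 = y \<and>
    of_real (norm v / \<eta>) *s deriv_vec f 0 = v"
proof (cases "v = 0")
  \<comment> \<open>For \<open>v = 0\<close> no radius can be formed; a constant disc serves, since
    the required multiplier is 0.\<close>
  case True
  have "deriv_vec (\<lambda>_. y) 0 = 0" by (simp add: deriv_vec_def vec_eq_iff)
  then show ?thesis using True assms
    by (intro exI[of _ "\<lambda>_. y"]) (auto simp: holomorphic_vec_def)
next
  case False
  define \<rho> where "\<rho> = \<eta> / norm v"
  have "\<rho> > 0" using False \<open>\<eta> > 0\<close> by (simp add: \<rho>_def)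
  have disc: "y + z *s v \<in> \<Omega>" if "cmod (z - of_real 0) < \<rho>" for z
  proof -
    have "norm (z *s v) < \<eta>"
      using that False by (simp add: norm_vector_scalar_mult \<rho>_def field_simps)
    then have "y + z *s v \<in> ball y \<eta>" by (simp add: dist_norm)
    then show ?thesis using assms(1) by blast
  qed
  have "\<exists>f. holomorphic_vec f (ball 0 1) \<and> f ` ball 0 1 \<subseteq> \<Omega> \<and> f 0 = y \<and>
      of_real (\<rho> / \<rho>\<^sup>2) *s deriv_vec f 0 = v"
    using affine_disc_competitor[of 0 \<rho> y v \<Omega> 0, OF disc] \<open>\<rho> > 0\<close>
    by (simp del: of_real_divide of_real_power)
  moreover have "\<rho> / \<rho>\<^sup>2 = norm v / \<eta>" using \<open>\<rho> > 0\<close> by (simp add: \<rho>_def power2_eq_square)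
  ultimately show ?thesis by (simp only:)
qed

lemma kobayashi_metric_ball_le:
  fixes y v :: "complex ^ 'd"
  assumes "ball y \<eta> \<subseteq> \<Omega>" "\<eta> > 0"
  shows "kobayashi_metric \<Omega> y v \<le> norm v / \<eta>"
proof -
  obtain f where "holomorphic_vec f (ball 0 1)" "f ` ball 0 1 \<subseteq> \<Omega>" "f 0 = y"
    "of_real (norm v / \<eta>) *s deriv_vec f 0 = v"
    using ball_competitor[OF assms] by blast
  from kobayashi_metric_le[OF this] show ?thesis using assms(2) by (simp del: of_real_divide)
qed

lemma kobayashi_dist_le:
  assumes "a < b" "abs_continuous_curve a b \<sigma>" "\<sigma> ` {a..b} \<subseteq> \<Omega>" "\<sigma> a = x" "\<sigma> b = y"
    and "kobayashi_length \<Omega> a b \<sigma> \<le> ennreal L" "0 \<le> L"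
  shows "kobayashi_dist \<Omega> x y \<le> ereal L"
proof -
  have "Inf {kobayashi_length \<Omega> a b \<sigma> | a b \<sigma>.
      a < b \<and> abs_continuous_curve a b \<sigma> \<and> \<sigma> ` {a..b} \<subseteq> \<Omega> \<and> \<sigma> a = x \<and> \<sigma> b = y} \<le> ennreal L"
    using assms by (intro Inf_lower2[OF _ assms(6)]) blast
  then show ?thesis
    unfolding kobayashi_dist_def using \<open>0 \<le> L\<close> by (auto simp: less_eq_ennreal.rep_eq)
qed

lemma ball_convex_combination:
  fixes x y :: "'a::real_normed_vector"
  assumes "convex S" "ball x \<eta> \<subseteq> S" "ball y \<eta> \<subseteq> S" "0 \<le> u" "u \<le> 1"
  shows "ball (x + u *\<^sub>R (y - x)) \<eta> \<subseteq> S"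
proof
  fix z assume z: "z \<in> ball (x + u *\<^sub>R (y - x)) \<eta>"
  define h where "h = z - (x + u *\<^sub>R (y - x))"
  have "norm h < \<eta>" using z by (simp add: h_def dist_norm norm_minus_commute)
  then have "x + h \<in> S" "y + h \<in> S" using assms(2,3) by (auto simp: subset_iff dist_norm)
  then have "(1 - u) *\<^sub>R (x + h) + u *\<^sub>R (y + h) \<in> S"
    using assms(1,4,5) by (simp add: convex_alt)
  also have "(1 - u) *\<^sub>R (x + h) + u *\<^sub>R (y + h) = z" by (simp add: h_def algebra_simps)
  finally show "z \<in> S" .
qed

text \<open>After the ray, the segment to \<open>z0\<close> is run through in unit time. By
  convexity a ball of radius \<eta> about each of its points stays in the domain, so the bound on
  the metric there is also a bound on the length.\<close>

lemma kobayashi_dist_broken_line_le: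
  fixes p n z0 :: "complex ^ 'd"
  assumes "t0 \<le> t1" "convex \<Omega>" and ray: "\<And>t. t \<in> {t0..t1} \<Longrightarrow> p + t *\<^sub>R n \<in> \<Omega>"
    and g: "g \<in> borel_measurable borel"
      "\<And>t. t \<in> {t0<..<t1} \<Longrightarrow> kobayashi_metric \<Omega> (p + t *\<^sub>R n) n \<le> g t"
      "(\<integral>\<^sup>+ t\<in>{t0..t1}. ennreal (g t) \<partial>lebesgue) \<le> ennreal L" "0 \<le> L"
    and \<eta>: "\<eta> > 0" "ball (p + t1 *\<^sub>R n) \<eta> \<subseteq> \<Omega>" "ball z0 \<eta> \<subseteq> \<Omega>"
  shows "kobayashi_dist \<Omega> (p + t0 *\<^sub>R n) z0 \<le> ereal (L + norm (z0 - (p + t1 *\<^sub>R n)) / \<eta>)"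
proof -
  define x where "x = p + t1 *\<^sub>R n"
  define M where "M = norm (z0 - x) / \<eta>"
  have "M \<ge> 0" using \<eta>(1) by (simp add: M_def)
  \<comment> \<open>One formula covers both legs: \<open>min\<close> stops the motion along
    \<open>n\<close> at \<open>t1\<close>, \<open>max\<close> starts the motion towards
    \<open>z0\<close> there. The Lipschitz estimate follows without case distinction.\<close>
  define \<sigma> where "\<sigma> t = p + min t t1 *\<^sub>R n + (max t t1 - t1) *\<^sub>R (z0 - x)" for t
  have left: "\<sigma> t = p + t *\<^sub>R n" if "t \<le> t1" for t using that by (simp add: \<sigma>_def)
  have right: "\<sigma> t = x + (t - t1) *\<^sub>R (z0 - x)" if "t1 \<le> t" for t using that by (simp add: \<sigma>_def x_def)
  have seg: "ball (\<sigma> t) \<eta> \<subseteq> \<Omega>" if "t1 \<le> t" "t \<le> t1 + 1" for t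
    unfolding right[OF that(1)]
    using \<eta> that \<open>convex \<Omega>\<close> by (intro ball_convex_combination) (auto simp: x_def)
  have "abs_continuous_curve t0 (t1 + 1) \<sigma>"
  proof (rule Lipschitz_imp_abs_continuous_curve)
    fix s t :: real assume "s \<le> t"
    have "\<sigma> t - \<sigma> s = (min t t1 - min s t1) *\<^sub>R n + (max t t1 - max s t1) *\<^sub>R (z0 - x)"
      by (simp add: \<sigma>_def algebra_simps)
    then have "norm (\<sigma> t - \<sigma> s) \<le> \<bar>min t t1 - min s t1\<bar> * norm n + \<bar>max t t1 - max s t1\<bar> * norm (z0 - x)"
      by (metis norm_triangle_ineq norm_scaleR)
    also have "\<dots> \<le> (t - s) * norm n + (t - s) * norm (z0 - x)"
      using \<open>s \<le> t\<close> by (intro add_mono mult_right_mono) auto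
    finally show "norm (\<sigma> t - \<sigma> s) \<le> (norm n + norm (z0 - x)) * (t - s)"
      by (simp add: algebra_simps)
  qed
  moreover have "\<sigma> ` {t0..t1 + 1} \<subseteq> \<Omega>"
  proof safe
    fix t assume t: "t \<in> {t0..t1 + 1}"
    show "\<sigma> t \<in> \<Omega>"
    proof (cases "t \<le> t1")
      case True
      then show ?thesis using ray[of t] t by (simp add: left)
    next
      case False
      then have "ball (\<sigma> t) \<eta> \<subseteq> \<Omega>" using t by (intro seg) auto
      then show ?thesis using \<eta>(1) centre_in_ball by blast
    qed
  qed
  moreover have "kobayashi_length \<Omega> t0 (t1 + 1) \<sigma> \<le> ennreal (L + M)"
  proof -
    have bound: "ennreal (kobayashi_metric \<Omega> (\<sigma> t) (vector_derivative \<sigma> (at t))) * indicator {t0..t1 + 1} t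
        \<le> ennreal (g t) * indicator {t0..t1} t + ennreal M * indicator {t1..t1 + 1} t"
      if tne: "t \<notin> {t0, t1}" for t
    proof -
      consider "t \<notin> {t0..t1 + 1}" | "t0 < t" "t < t1" | "t1 < t" "t \<le> t1 + 1"
        using tne \<open>t0 \<le> t1\<close> by (cases "t < t0"; cases "t < t1"; cases "t \<le> t1 + 1") auto
      then show ?thesis
      proof cases
        case 1
        then show ?thesis by simp
      next
        case 2
        have "(\<sigma> has_vector_derivative n) (at t)"
        proof (rule has_vector_derivative_transform_within_open)
          show "((\<lambda>t. p + t *\<^sub>R n) has_vector_derivative n) (at t)"
            by (auto intro!: derivative_eq_intros)
          show "open {..<t1}" "t \<in> {..<t1}" using 2 by auto
        qed (simp add: left)
        then have "vector_derivative \<sigma> (at t) = n" by (rule vector_derivative_at)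
        then show ?thesis using 2 g(2)[of t] by (simp add: left ennreal_leI)
      next
        case 3
        have "(\<sigma> has_vector_derivative (z0 - x)) (at t)"
        proof (rule has_vector_derivative_transform_within_open)
          show "((\<lambda>t. x + (t - t1) *\<^sub>R (z0 - x)) has_vector_derivative (z0 - x)) (at t)"
            by (auto intro!: derivative_eq_intros)
          show "open {t1<..}" "t \<in> {t1<..}" using 3 by auto
        qed (simp add: right)
        then have "vector_derivative \<sigma> (at t) = z0 - x" by (rule vector_derivative_at)
        then have "kobayashi_metric \<Omega> (\<sigma> t) (vector_derivative \<sigma> (at t)) \<le> M"
          using 3 \<eta>(1) seg[of t] unfolding M_def by (simp add: kobayashi_metric_ball_le)
        then show ?thesis using 3 \<open>t0 \<le> t1\<close> by (simp add: ennreal_leI)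
      qed
    qed
    \<comment> \<open>The curve may have a corner at \<open>t1\<close>, and the bound by
      \<open>g\<close> is assumed only in the open interval; two points do not affect the
      integral.\<close>
    have ae: "AE t in lebesgue. t \<notin> {t0, t1}"
      by (rule AE_not_in) (simp add: negligible_iff_null_sets[symmetric] negligible_finite)
    have "kobayashi_length \<Omega> t0 (t1 + 1) \<sigma>
        \<le> (\<integral>\<^sup>+ t. ennreal (g t) * indicator {t0..t1} t + ennreal M * indicator {t1..t1 + 1} t \<partial>lebesgue)"
      unfolding kobayashi_length_def by (rule nn_integral_mono_AE, rule eventually_mono[OF ae], rule bound)
    also have "\<dots> = (\<integral>\<^sup>+ t. ennreal (g t) * indicator {t0..t1} t \<partial>lebesgue)
        + (\<integral>\<^sup>+ t. ennreal M * indicator {t1..t1 + 1} t \<partial>lebesgue)"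
      using g(1) by (intro nn_integral_add measurable_completion) auto
    also have "\<dots> \<le> ennreal L + ennreal M"
      using g(3) by (intro add_mono) (auto simp: nn_integral_cmult_indicator)
    finally show ?thesis using \<open>0 \<le> L\<close> \<open>M \<ge> 0\<close> by simp
  qed
  moreover have "\<sigma> t0 = p + t0 *\<^sub>R n" using \<open>t0 \<le> t1\<close> by (simp add: left)
  moreover have "\<sigma> (t1 + 1) = z0" by (simp add: right)
  ultimately show ?thesis
    using \<open>t0 \<le> t1\<close> \<open>0 \<le> L\<close> \<open>M \<ge> 0\<close> unfolding M_def x_def by (intro kobayashi_dist_le) auto
qed

section \<open>Interior balls at a \<open>C\<^sup>1\<close> boundary\<close>

text \<open>A negative value would put \<open>p\<close> into the open set \<Omega>, and a positive
  one would keep a neighbourhood of \<open>p\<close> away from \<Omega>.\<close>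

lemma frontier_defining_function_eq_0:
  fixes r :: "'a::euclidean_space \<Rightarrow> real"
  assumes "open \<Omega>" "p \<in> frontier \<Omega>" "open U" "p \<in> U" "isCont r p" "\<Omega> \<inter> U = {x \<in> U. r x < 0}"
  shows "r p = 0"
proof (rule antisym)
  have "p \<notin> \<Omega> \<inter> U" using assms(1,2) frontier_disjoint_eq[of \<Omega>] by blast
  then show "r p \<ge> 0" unfolding assms(6) using assms(4) by auto
  show "r p \<le> 0"
  proof (rule ccontr)
    assume "\<not> r p \<le> 0"
    then have "\<forall>\<^sub>F x in at p. r x > 0"
      using assms(5) unfolding isCont_def by (intro order_tendstoD) auto
    then have "\<forall>\<^sub>F x in nhds p. r x > 0"
      using \<open>\<not> r p \<le> 0\<close> by (simp add: eventually_nhds_conv_at)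
    then obtain V where V: "open V" "p \<in> V" "\<And>x. x \<in> V \<Longrightarrow> r x > 0"
      unfolding eventually_nhds by blast
    have "p \<in> closure \<Omega>" using assms(2) by (simp add: frontier_def)
    then have "\<Omega> \<inter> (U \<inter> V) \<noteq> {}"
      using open_Int_closure_eq_empty[of "U \<inter> V" \<Omega>] V assms(3,4) by auto
    then obtain x where "x \<in> \<Omega> \<inter> U" "x \<in> V" by blast
    then show False using V(3)[of x] assms(6) by auto
  qed
qed

text \<open>With \<open>u\<close> the unit vector along \<open>g\<close> and 0 < \<theta> < 1, short
  steps from \<open>p\<close> along \<open>n + \<theta> *\<^sub>R u\<close> enter the tangent ball,
  where \<open>r\<close> is negative. Hence \<open>g \<bullet> n \<le> - \<theta> * norm g\<close>,
  and \<theta> tending to 1 gives equality in the Cauchy-Schwarz inequality.\<close>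

lemma interior_ball_normal:
  fixes r :: "'a::euclidean_space \<Rightarrow> real"
  assumes r: "(r has_derivative (\<lambda>h. g \<bullet> h)) (at p)" "r p = 0" "g \<noteq> 0"
    and U: "open U" "p \<in> U" and neg: "\<And>x. x \<in> ball (p + \<delta> *\<^sub>R n) \<delta> \<Longrightarrow> x \<in> U \<Longrightarrow> r x < 0"
    and n: "norm n = 1" "\<delta> > 0"
  shows "n = - (1 / norm g) *\<^sub>R g"
proof -
  define u where "u = (1 / norm g) *\<^sub>R g"
  have u: "norm u = 1" "g \<bullet> u = norm g" using r(3) by (auto simp: u_def dot_square_norm power2_eq_square)
  have *: "g \<bullet> n \<le> - \<theta> * norm g" if \<theta>: "0 < \<theta>" "\<theta> < 1" for \<theta>
  proof -
    define y where "y = n + \<theta> *\<^sub>R u"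
    have y: "g \<bullet> y = g \<bullet> n + \<theta> * norm g" by (simp add: y_def inner_right_distrib u)
    have lim: "((\<lambda>\<tau>. r (p + \<tau> *\<^sub>R y)) has_real_derivative g \<bullet> y) (at 0)"
    proof -
      have "((\<lambda>\<tau>. p + \<tau> *\<^sub>R y) has_derivative (\<lambda>\<tau>. \<tau> *\<^sub>R y)) (at 0)"
        by (auto intro!: derivative_eq_intros)
      moreover have "(r has_derivative (\<lambda>h. g \<bullet> h)) (at (p + 0 *\<^sub>R y))" using r(1) by simp
      ultimately have "((\<lambda>\<tau>. r (p + \<tau> *\<^sub>R y)) has_derivative (\<lambda>\<tau>. g \<bullet> (\<tau> *\<^sub>R y))) (at 0)"
        by (rule has_derivative_compose)
      then show ?thesis by (simp add: has_field_derivative_def mult_commute_abs)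
    qed
    have "g \<bullet> y \<le> 0"
    proof (rule ccontr)
      assume "\<not> g \<bullet> y \<le> 0"
      then obtain d where d: "d > 0" "\<And>h. \<lbrakk>0 < h; h < d\<rbrakk> \<Longrightarrow> r (p + 0 *\<^sub>R y) < r (p + (0 + h) *\<^sub>R y)"
        using DERIV_pos_inc_right[OF lim] by auto
      have "((\<lambda>\<tau>. p + \<tau> *\<^sub>R y) \<longlongrightarrow> p + 0 *\<^sub>R y) (at_right 0)" by (intro tendsto_intros)
      then have "\<forall>\<^sub>F \<tau> in at_right 0. p + \<tau> *\<^sub>R y \<in> U"
        using U by (intro topological_tendstoD) auto
      moreover have "\<forall>\<^sub>F \<tau> in at_right (0::real). \<tau> \<in> {0<..<min d (min \<delta> 1)}"
        by (rule eventually_at_right_real) (use d n in auto)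
      ultimately have "\<forall>\<^sub>F \<tau> in at_right (0::real). p + \<tau> *\<^sub>R y \<in> U \<and> \<tau> \<in> {0<..<min d (min \<delta> 1)}"
        by (rule eventually_conj)
      then obtain \<tau> where \<tau>: "p + \<tau> *\<^sub>R y \<in> U" "0 < \<tau>" "\<tau> < d" "\<tau> < \<delta>"
        using eventually_happens[of _ "at_right (0::real)"] by auto
      have "p + \<delta> *\<^sub>R n - (p + \<tau> *\<^sub>R y) = (\<delta> - \<tau>) *\<^sub>R n - (\<tau> * \<theta>) *\<^sub>R u"
        by (simp add: y_def algebra_simps)
      then have "norm (p + \<delta> *\<^sub>R n - (p + \<tau> *\<^sub>R y)) \<le> (\<delta> - \<tau>) + \<tau> * \<theta>"
        using norm_triangle_ineq4[of "(\<delta> - \<tau>) *\<^sub>R n" "(\<tau> * \<theta>) *\<^sub>R u"] n u \<tau> \<theta> by simp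
      also have "\<dots> < \<delta>" using \<tau> \<theta> by simp
      finally have "p + \<tau> *\<^sub>R y \<in> ball (p + \<delta> *\<^sub>R n) \<delta>" by (simp add: dist_norm)
      then have "r (p + \<tau> *\<^sub>R y) < 0" using neg \<tau>(1) by blast
      moreover have "r (p + \<tau> *\<^sub>R y) > 0" using d(2)[of \<tau>] \<tau> r(2) by simp
      ultimately show False by simp
    qed
    then show ?thesis using y by simp
  qed
  have "g \<bullet> n \<le> - norm g"
  proof (rule field_le_epsilon)
    fix e :: real assume "e > 0"
    \<comment> \<open>The maximum with 1/2 keeps \<theta> positive when \<open>e\<close> exceeds
      \<open>norm g\<close>.\<close>
    define \<theta> where "\<theta> = max (1/2) (1 - e / norm g)"
    have "0 < \<theta>" "\<theta> < 1" using \<open>e > 0\<close> r(3) by (auto simp: \<theta>_def)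
    then have "g \<bullet> n \<le> - \<theta> * norm g" by (rule *)
    also have "\<dots> \<le> - (1 - e / norm g) * norm g" by (intro mult_right_mono) (auto simp: \<theta>_def)
    also have "\<dots> = - norm g + e" using r(3) by (simp add: field_simps)
    finally show "g \<bullet> n \<le> - norm g + e" .
  qed
  then have "u \<bullet> n \<le> -1" using r(3) by (simp add: u_def field_simps)
  have "(norm (n + u))\<^sup>2 = 2 + 2 * (u \<bullet> n)"
  proof -
    have "(norm (n + u))\<^sup>2 = (norm n)\<^sup>2 + (norm u)\<^sup>2 + 2 * (u \<bullet> n)"
      unfolding power2_norm_eq_inner by (simp add: inner_left_distrib inner_right_distrib inner_commute[of n u])
    then show ?thesis using n(1) u(1) by simp
  qed
  also have "\<dots> \<le> 0" using \<open>u \<bullet> n \<le> -1\<close> by simp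
  finally have "n + u = 0" by simp
  then show ?thesis by (simp add: u_def eq_neg_iff_add_eq_0)
qed

text \<open>Differentiability is used to build a ball only at \<open>p0\<close>, for one
  \<open>c\<close> and a ratio \<open>s'\<close> larger than \<open>s\<close>. For nearby
  \<open>p\<close> the continuity of the normal moves the centre by less than
  \<open>(s' - s) * c\<close>, so the ball of ratio \<open>s\<close> fits into the one at
  \<open>p0\<close>. A tangent ball of any radius identifies \<open>n\<close> as the inner normal
  without reference to the local defining function.\<close>

lemma C1_boundary_local_interior_balls:
  fixes \<Omega> :: "'a::euclidean_space set"
  assumes C1: "C1_boundary \<Omega>" and "open \<Omega>" "p0 \<in> frontier \<Omega>" "0 < s" "s < 1"
  shows "\<exists>e>0. \<exists>c>0. \<forall>p\<in>frontier \<Omega> \<inter> ball p0 e. \<forall>n \<delta>.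
    norm n = 1 \<and> \<delta> > 0 \<and> ball (p + \<delta> *\<^sub>R n) \<delta> \<subseteq> \<Omega> \<longrightarrow> ball (p + c *\<^sub>R n) (s * c) \<subseteq> \<Omega>"
proof -
  obtain U r g where U: "open U" "p0 \<in> U" and r: "\<And>x. x \<in> U \<Longrightarrow> (r has_derivative (\<lambda>h. g x \<bullet> h)) (at x)"
      and g: "continuous_on U g" "\<And>x. x \<in> U \<Longrightarrow> g x \<noteq> 0" and \<Omega>U: "\<Omega> \<inter> U = {x\<in>U. r x < 0}"
    using bspec[OF C1[unfolded C1_boundary_def] \<open>p0 \<in> frontier \<Omega>\<close>] by blast
  have r0: "r p = 0" if "p \<in> frontier \<Omega>" "p \<in> U" for p
    using frontier_defining_function_eq_0[OF \<open>open \<Omega>\<close> that(1) U(1) that(2) _ \<Omega>U] r[OF that(2)]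
      has_derivative_continuous by blast
  define \<nu> where "\<nu> p = - (1 / norm (g p)) *\<^sub>R g p" for p
  have \<nu>: "norm (\<nu> p) = 1" "g p = - norm (g p) *\<^sub>R \<nu> p" if "p \<in> U" for p
    using g(2)[OF that] by (auto simp: \<nu>_def)
  define s' where "s' = (1 + s) / 2"
  have s': "s < s'" "s' < 1" "0 < s'" using \<open>0 < s\<close> \<open>s < 1\<close> by (auto simp: s'_def)
  \<comment> \<open>In the ball about \<open>p0 + c *\<^sub>R \<nu> p0\<close> the linear part is at
    most \<open>- norm (g p0) * c * (1 - s')\<close>, and points are within \<open>2 * c\<close> of
    \<open>p0\<close>. This \<kappa> makes the remainder at most half of that gain.\<close>
  define \<kappa> where "\<kappa> = norm (g p0) * (1 - s') / 4"
  have "\<kappa> > 0" using g(2)[OF U(2)] s' by (simp add: \<kappa>_def)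
  obtain d1 where d1: "d1 > 0" "\<And>y. norm (y - p0) < d1 \<Longrightarrow>
      norm (r y - r p0 - g p0 \<bullet> (y - p0)) \<le> \<kappa> * norm (y - p0)"
    using r[OF U(2)] \<open>\<kappa> > 0\<close> unfolding has_derivative_at_alt by blast
  obtain d2 where d2: "d2 > 0" "ball p0 d2 \<subseteq> U" using U openE by blast
  define c where "c = min d1 d2 / 4"
  have "c > 0" using d1 d2 by (simp add: c_def)
  have big: "ball (p0 + c *\<^sub>R \<nu> p0) (s' * c) \<subseteq> \<Omega>"
  proof
    fix y assume y: "y \<in> ball (p0 + c *\<^sub>R \<nu> p0) (s' * c)"
    define h where "h = y - p0 - c *\<^sub>R \<nu> p0"
    have h: "norm h < s' * c" using y by (simp add: h_def dist_norm norm_minus_commute algebra_simps)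
    have yp: "y - p0 = c *\<^sub>R \<nu> p0 + h" by (simp add: h_def)
    have "s' * c < c" using s' \<open>c > 0\<close> by simp
    have "norm (y - p0) \<le> c + norm h"
      unfolding yp using norm_triangle_ineq[of "c *\<^sub>R \<nu> p0" h] \<nu>(1)[OF U(2)] \<open>c > 0\<close> by simp
    then have le2c: "norm (y - p0) < 2 * c" using h \<open>s' * c < c\<close> by linarith
    then have "norm (y - p0) < d1" "norm (y - p0) < d2" using d1 d2 by (auto simp: c_def)
    then have "y \<in> U" using d2 by (auto simp: dist_norm norm_minus_commute)
    have "\<bar>\<nu> p0 \<bullet> h\<bar> \<le> norm h" using Cauchy_Schwarz_ineq2[of "\<nu> p0" h] \<nu>(1)[OF U(2)] by simp
    then have "\<nu> p0 \<bullet> (y - p0) > c * (1 - s')"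
      unfolding yp using h \<nu>(1)[OF U(2)] by (simp add: inner_right_distrib dot_square_norm algebra_simps)
    then have "norm (g p0) * (\<nu> p0 \<bullet> (y - p0)) \<ge> norm (g p0) * (c * (1 - s'))"
      by (intro mult_left_mono) auto
    then have "g p0 \<bullet> (y - p0) \<le> - (norm (g p0) * (c * (1 - s')))"
      by (subst \<nu>(2)[OF U(2)]) simp
    moreover have "r y \<le> g p0 \<bullet> (y - p0) + \<kappa> * norm (y - p0)"
      using d1(2)[OF \<open>norm (y - p0) < d1\<close>] r0[OF \<open>p0 \<in> frontier \<Omega>\<close> U(2)] by simp
    moreover have "\<kappa> * norm (y - p0) < \<kappa> * (2 * c)"
      using le2c \<open>\<kappa> > 0\<close> by (rule mult_strict_left_mono)
    moreover have "\<kappa> * (2 * c) = norm (g p0) * (c * (1 - s')) / 2" "norm (g p0) * (c * (1 - s')) \<ge> 0"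
      using s' \<open>c > 0\<close> by (auto simp: \<kappa>_def)
    ultimately have "r y < 0" by linarith
    then show "y \<in> \<Omega>" using \<open>y \<in> U\<close> \<Omega>U by blast
  qed
  have "continuous_on U \<nu>"
    unfolding \<nu>_def using g by (intro continuous_intros) auto
  then have "isCont (\<lambda>p. dist p p0 + c * dist (\<nu> p) (\<nu> p0)) p0"
    using U by (intro continuous_intros) (simp add: continuous_on_eq_continuous_at)
  then have "((\<lambda>p. dist p p0 + c * dist (\<nu> p) (\<nu> p0)) \<longlongrightarrow> 0) (at p0)"
    unfolding isCont_def by simp
  then have "\<forall>\<^sub>F p in at p0. dist p p0 + c * dist (\<nu> p) (\<nu> p0) < (s' - s) * c"
    using s' \<open>c > 0\<close> by (intro order_tendstoD) auto
  then have "\<forall>\<^sub>F p in nhds p0. dist p p0 + c * dist (\<nu> p) (\<nu> p0) < (s' - s) * c"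
    using s' \<open>c > 0\<close> by (simp add: eventually_nhds_conv_at)
  moreover have "\<forall>\<^sub>F p in nhds p0. p \<in> U" using U by (rule eventually_nhds_in_open)
  ultimately have "\<forall>\<^sub>F p in nhds p0. dist p p0 + c * dist (\<nu> p) (\<nu> p0) < (s' - s) * c \<and> p \<in> U"
    by (rule eventually_conj)
  then obtain e where e: "e > 0" "\<And>p. dist p p0 < e \<Longrightarrow> dist p p0 + c * dist (\<nu> p) (\<nu> p0) < (s' - s) * c \<and> p \<in> U"
    unfolding eventually_nhds_metric by blast
  have "ball (p + c *\<^sub>R n) (s * c) \<subseteq> \<Omega>"
    if p: "p \<in> frontier \<Omega> \<inter> ball p0 e" and n: "norm n = 1" "\<delta> > 0" "ball (p + \<delta> *\<^sub>R n) \<delta> \<subseteq> \<Omega>" for p n \<delta>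
  proof -
    have pe: "p \<in> U" "dist p p0 + c * dist (\<nu> p) (\<nu> p0) < (s' - s) * c"
      using e(2)[of p] p by (auto simp: dist_commute)
    have "n = \<nu> p"
      unfolding \<nu>_def
    proof (rule interior_ball_normal[OF r[OF pe(1)] _ g(2)[OF pe(1)] U(1) pe(1) _ n(1,2)])
      show "r p = 0" using p pe r0 by blast
      show "r x < 0" if "x \<in> ball (p + \<delta> *\<^sub>R n) \<delta>" "x \<in> U" for x
        using that n(3) \<Omega>U by blast
    qed
    have "dist (p + c *\<^sub>R n) (p0 + c *\<^sub>R \<nu> p0) \<le> dist p p0 + c * dist (\<nu> p) (\<nu> p0)"
    proof -
      have eq: "p + c *\<^sub>R n - (p0 + c *\<^sub>R \<nu> p0) = (p - p0) + c *\<^sub>R (\<nu> p - \<nu> p0)"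
        using \<open>n = \<nu> p\<close> by (simp add: algebra_simps)
      show ?thesis
        unfolding dist_norm eq
        using norm_triangle_ineq[of "p - p0" "c *\<^sub>R (\<nu> p - \<nu> p0)"] \<open>c > 0\<close> by simp
    qed
    then have "dist (p + c *\<^sub>R n) (p0 + c *\<^sub>R \<nu> p0) + s * c \<le> s' * c"
      using pe(2) by (simp add: algebra_simps)
    then have "ball (p + c *\<^sub>R n) (s * c) \<subseteq> ball (p0 + c *\<^sub>R \<nu> p0) (s' * c)"
      by (simp add: subset_ball ball_subset_ball_iff)
    then show ?thesis using big by blast
  qed
  then show ?thesis using \<open>e > 0\<close> \<open>c > 0\<close> by blast
qed

text \<open>The homothety with centre \<open>p\<close> and ratio \<tau> maps one ball onto the
  other. As \<open>p\<close> is only in the closure, its image lies in \<Omega> because segments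
  from \<open>p\<close> to interior points are interior beyond \<open>p\<close>.\<close>

lemma convex_ball_shrink:
  fixes p v :: "'a::euclidean_space"
  assumes "convex \<Omega>" "open \<Omega>" "p \<in> closure \<Omega>" "ball (p + v) \<rho> \<subseteq> \<Omega>" "0 < \<tau>" "\<tau> \<le> 1"
  shows "ball (p + \<tau> *\<^sub>R v) (\<tau> * \<rho>) \<subseteq> \<Omega>"
proof
  fix x assume x: "x \<in> ball (p + \<tau> *\<^sub>R v) (\<tau> * \<rho>)"
  define y where "y = p + (1 / \<tau>) *\<^sub>R (x - p)"
  have "p + v - y = (1 / \<tau>) *\<^sub>R (p + \<tau> *\<^sub>R v - x)"
    using \<open>0 < \<tau>\<close> by (simp add: y_def algebra_simps)
  then have "norm (p + v - y) = norm (p + \<tau> *\<^sub>R v - x) / \<tau>"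
    using \<open>0 < \<tau>\<close> by simp
  also have "\<dots> < \<tau> * \<rho> / \<tau>"
    using x \<open>0 < \<tau>\<close> by (intro divide_strict_right_mono) (auto simp: dist_norm)
  also have "\<dots> = \<rho>" using \<open>0 < \<tau>\<close> by simp
  finally have "y \<in> \<Omega>" using assms(4) by (auto simp: dist_norm)
  then have "p - \<tau> *\<^sub>R (p - y) \<in> interior \<Omega>"
    using assms by (intro mem_interior_closure_convex_shrink) (auto simp: interior_open)
  moreover have "p - \<tau> *\<^sub>R (p - y) = x" using \<open>0 < \<tau>\<close> by (simp add: y_def algebra_simps)
  ultimately show "x \<in> \<Omega>" using \<open>open \<Omega>\<close> by (simp add: interior_open)
qed

text \<open>The local result fixes one \<open>c\<close> near each boundary point. Compactness leaves
  finitely many of them, and shrinking towards \<open>p\<close> by convexity yields every smaller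
  radius.\<close>

lemma C1_boundary_uniform_interior_balls:
  fixes \<Omega> :: "'a::euclidean_space set"
  assumes C1: "C1_boundary \<Omega>" and "open \<Omega>" "bounded \<Omega>" "convex \<Omega>" "0 < s" "s < 1"
  shows "\<exists>c>0. \<forall>p n \<delta> c'. p \<in> frontier \<Omega> \<and> norm n = 1 \<and> \<delta> > 0 \<and> ball (p + \<delta> *\<^sub>R n) \<delta> \<subseteq> \<Omega> \<and>
    0 < c' \<and> c' \<le> c \<longrightarrow> ball (p + c' *\<^sub>R n) (s * c') \<subseteq> \<Omega>"
proof -
  define P where "P p c \<longleftrightarrow> (\<forall>n \<delta>. norm n = 1 \<and> \<delta> > 0 \<and> ball (p + \<delta> *\<^sub>R n) \<delta> \<subseteq> \<Omega> \<longrightarrow>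
    ball (p + c *\<^sub>R n) (s * c) \<subseteq> \<Omega>)" for p c
  have shrink: "ball (p + c' *\<^sub>R n) (s * c') \<subseteq> \<Omega>"
    if "p \<in> frontier \<Omega>" "ball (p + c *\<^sub>R n) (s * c) \<subseteq> \<Omega>" "0 < c'" "c' \<le> c" for p n c c'
    using convex_ball_shrink[of \<Omega> p "c *\<^sub>R n" "s * c" "c' / c"] that \<open>open \<Omega>\<close> \<open>convex \<Omega>\<close>
    by (simp add: frontier_def mult_ac)
  have "\<forall>p0\<in>frontier \<Omega>. \<exists>ec. fst ec > 0 \<and> snd ec > 0 \<and> (\<forall>p\<in>frontier \<Omega> \<inter> ball p0 (fst ec). P p (snd ec))"
  proof
    fix p0 assume "p0 \<in> frontier \<Omega>"
    from C1_boundary_local_interior_balls[OF C1 \<open>open \<Omega>\<close> this \<open>0 < s\<close> \<open>s < 1\<close>]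
    obtain e c where "e > 0" "c > 0" "\<forall>p\<in>frontier \<Omega> \<inter> ball p0 e. P p c"
      unfolding P_def by blast
    then show "\<exists>ec. fst ec > 0 \<and> snd ec > 0 \<and> (\<forall>p\<in>frontier \<Omega> \<inter> ball p0 (fst ec). P p (snd ec))"
      by (intro exI[of _ "(e, c)"]) auto
  qed
  from bchoice[OF this] obtain ec where
    ec: "\<forall>p0\<in>frontier \<Omega>. fst (ec p0) > 0 \<and> snd (ec p0) > 0 \<and>
      (\<forall>p\<in>frontier \<Omega> \<inter> ball p0 (fst (ec p0)). P p (snd (ec p0)))"
    by blast
  have "compact (frontier \<Omega>)" using \<open>bounded \<Omega>\<close> by (rule compact_frontier_bounded)
  then obtain F where F: "F \<subseteq> frontier \<Omega>" "finite F" "frontier \<Omega> \<subseteq> (\<Union>p0\<in>F. ball p0 (fst (ec p0)))"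
  proof (rule compactE_image[of _ "frontier \<Omega>" "\<lambda>p0. ball p0 (fst (ec p0))"])
    show "frontier \<Omega> \<subseteq> (\<Union>p0\<in>frontier \<Omega>. ball p0 (fst (ec p0)))"
      using ec by (meson UN_I centre_in_ball subsetI)
  qed auto
  \<comment> \<open>The inserted 1 keeps the minimum over a nonempty set when \<open>F\<close> is
    empty.\<close>
  define c where "c = Min (insert 1 ((\<lambda>p0. snd (ec p0)) ` F))"
  have "c > 0" using F ec by (auto simp: c_def)
  have "ball (p + c' *\<^sub>R n) (s * c') \<subseteq> \<Omega>"
    if H: "p \<in> frontier \<Omega>" "norm n = 1" "\<delta> > 0" "ball (p + \<delta> *\<^sub>R n) \<delta> \<subseteq> \<Omega>" "0 < c'" "c' \<le> c"
    for p n :: 'a and \<delta> c' :: real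
  proof -
    obtain p0 where p0: "p0 \<in> F" "p \<in> ball p0 (fst (ec p0))" using F(3) H(1) by blast
    then have "P p (snd (ec p0))" using ec F(1) H(1) by blast
    then have big: "ball (p + snd (ec p0) *\<^sub>R n) (s * snd (ec p0)) \<subseteq> \<Omega>"
      using H unfolding P_def by blast
    have "c \<le> snd (ec p0)" using p0(1) F(2) by (simp add: c_def)
    then have "c' \<le> snd (ec p0)" using H(6) by simp
    then show "ball (p + c' *\<^sub>R n) (s * c') \<subseteq> \<Omega>"
      by (rule shrink[OF H(1) big H(5)])
  qed
  then show ?thesis using \<open>c > 0\<close> by blast
qed

section \<open>The upper estimate for convex domains with \<open>C^1\<close> boundary\<close>

lemma nn_integral_const_over_id:
  assumes "0 < t0" "t0 \<le> t1" "0 \<le> C"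
  shows "(\<integral>\<^sup>+ t\<in>{t0..t1}. ennreal (C / t) \<partial>lebesgue) = ennreal (C * ln (t1 / t0))"
proof -
  have "(\<integral>\<^sup>+ t\<in>{t0..t1}. ennreal (C / t) \<partial>lebesgue) = (\<integral>\<^sup>+ t\<in>{t0..t1}. ennreal (C / t) \<partial>lborel)"
    by (intro nn_integral_completion)
  also have "\<dots> = ennreal (C * ln t1 - C * ln t0)"
  proof (rule nn_integral_FTC_Icc[where F = "\<lambda>t. C * ln t"])
    fix t assume "t \<in> {t0..t1}"
    then have "t > 0" using \<open>0 < t0\<close> by simp
    then show "((\<lambda>t. C * ln t) has_real_derivative C / t) (at t)" "0 \<le> C / t"
      using \<open>0 \<le> C\<close> by (auto intro!: derivative_eq_intros)
  qed (use assms in auto)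
  also have "C * ln t1 - C * ln t0 = C * ln (t1 / t0)"
    using assms by (simp add: ln_div algebra_simps)
  finally show ?thesis .
qed

lemma bdist_attained:
  assumes "bounded_convex_domain \<Omega>" "q \<in> \<Omega>"
  obtains p where "p \<in> frontier \<Omega>" "bdist \<Omega> q = dist q p" "bdist \<Omega> q > 0" "ball q (bdist \<Omega> q) \<subseteq> \<Omega>"
proof -
  have \<Omega>: "open \<Omega>" "bounded \<Omega>" using assms by (auto simp: bounded_convex_domain_def)
  have "frontier \<Omega> \<noteq> {}"
    using \<Omega>(2) assms(2) frontier_eq_empty[of \<Omega>] not_bounded_UNIV by auto
  then obtain p where p: "p \<in> frontier \<Omega>" "bdist \<Omega> q = dist q p"
    using infdist_attains_inf[OF frontier_closed, of \<Omega> q] by (auto simp: bdist_def)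
  have "q \<noteq> p" using p(1) assms(2) \<Omega>(1) frontier_disjoint_eq[of \<Omega>] by blast
  then have pos: "bdist \<Omega> q > 0" by (simp add: p(2))
  have "ball q (bdist \<Omega> q) \<subseteq> \<Omega>"
  proof (rule ccontr)
    assume "\<not> ?thesis"
    then have "ball q (bdist \<Omega> q) - \<Omega> \<noteq> {}" by blast
    moreover have "ball q (bdist \<Omega> q) \<inter> \<Omega> \<noteq> {}" using pos assms(2) by (metis IntI centre_in_ball empty_iff)
    ultimately have "ball q (bdist \<Omega> q) \<inter> frontier \<Omega> \<noteq> {}"
      by (intro connected_Int_frontier connected_ball)
    then obtain x where "x \<in> frontier \<Omega>" "dist q x < bdist \<Omega> q" by auto
    then show False using infdist_le[of x "frontier \<Omega>" q] by (simp add: bdist_def)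
  qed
  then show thesis using that p pos by blast
qed

text \<open>With \<open>c = t / \<lambda>\<close> and \<open>\<rho> = (1 - \<lambda>\<^sup>2) c\<close>, the metric of the disc of centre \<open>c\<close> and radius
  \<open>\<rho>\<close> at \<open>t\<close> is \<open>(1 + \<lambda>) / ((1 - \<lambda>) (2 + \<lambda>) t)\<close>.\<close>

lemma eccentric_disc_metric_le:
  fixes t l :: real
  assumes "t > 0" "0 < l" "l < 1"
  defines "c \<equiv> t / l"
  shows "\<bar>t - c\<bar> < (1 - l\<^sup>2) * c"
    and "(1 - l\<^sup>2) * c / (((1 - l\<^sup>2) * c)\<^sup>2 - (t - c)\<^sup>2) \<le> (1 + l) / (1 - l) / (2 * t)"
proof -
  have "c > 0" "t = l * c" using assms by (auto simp: c_def)
  have "l\<^sup>2 < l" using assms by (simp add: power2_eq_square)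
  have "t - c = - ((1 - l) * c)" using \<open>t = l * c\<close> by (simp add: algebra_simps)
  then have "\<bar>t - c\<bar> = (1 - l) * c" using \<open>c > 0\<close> assms by simp
  also have "\<dots> < (1 - l\<^sup>2) * c" using \<open>c > 0\<close> \<open>l\<^sup>2 < l\<close> by simp
  finally show "\<bar>t - c\<bar> < (1 - l\<^sup>2) * c" .
  have "((1 - l\<^sup>2) * c)\<^sup>2 - (t - c)\<^sup>2 = (1 - l) * ((1 - l) * (2 + l)) * (c * t)"
    unfolding \<open>t = l * c\<close> by (simp add: power2_eq_square algebra_simps)
  moreover have "(1 - l\<^sup>2) * c = (1 - l) * (1 + l) * c" by (simp add: power2_eq_square algebra_simps)
  ultimately have "(1 - l\<^sup>2) * c / (((1 - l\<^sup>2) * c)\<^sup>2 - (t - c)\<^sup>2)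
      = ((1 - l) * c * (1 + l)) / ((1 - l) * c * ((1 - l) * ((2 + l) * t)))"
    by (simp only: mult_ac)
  also have "\<dots> = (1 + l) / ((1 - l) * ((2 + l) * t))"
    using \<open>c > 0\<close> assms by (intro mult_divide_mult_cancel_left) auto
  also have "\<dots> \<le> (1 + l) / ((1 - l) * (2 * t))"
    using assms by (intro divide_left_mono mult_left_mono mult_right_mono mult_pos_pos) auto
  finally show "(1 - l\<^sup>2) * c / (((1 - l\<^sup>2) * c)\<^sup>2 - (t - c)\<^sup>2) \<le> (1 + l) / (1 - l) / (2 * t)"
    by simp
qed

theorem C1_convex_domain_kobayashi_dist_le:
  fixes \<Omega> :: "(complex ^ 'd) set"
  assumes dom: "bounded_convex_domain \<Omega>" and C1: "C1_boundary \<Omega>" and "\<epsilon> > 0" and z0: "z0 \<in> \<Omega>"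
  shows "\<exists>B>0. \<forall>q\<in>\<Omega>. kobayashi_dist \<Omega> q z0 \<le> ereal (B + (1 + \<epsilon>) / 2 * ln (1 / bdist \<Omega> q))"
proof -
  have \<Omega>: "open \<Omega>" "bounded \<Omega>" "convex \<Omega>" using dom by (auto simp: bounded_convex_domain_def)
  \<comment> \<open>The solution of \<open>(1 + l) / (1 - l) = 1 + \<epsilon>\<close>.\<close>
  define l where "l = \<epsilon> / (2 + \<epsilon>)"
  have l: "0 < l" "l < 1" "(1 + l) / (1 - l) = 1 + \<epsilon>" using \<open>\<epsilon> > 0\<close> by (auto simp: l_def field_simps)
  define s where "s = 1 - l\<^sup>2"
  have "l\<^sup>2 < l" using l by (simp add: power2_eq_square)
  then have s: "0 < s" "s < 1" "1 - l < s" using l by (auto simp: s_def)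
  obtain c where "c > 0" and c: "\<And>p n \<delta> c'. p \<in> frontier \<Omega> \<and> norm n = 1 \<and> \<delta> > 0 \<and>
      ball (p + \<delta> *\<^sub>R n) \<delta> \<subseteq> \<Omega> \<and> 0 < c' \<and> c' \<le> c \<Longrightarrow> ball (p + c' *\<^sub>R n) (s * c') \<subseteq> \<Omega>"
    using C1_boundary_uniform_interior_balls[OF C1 \<Omega> s(1,2)] by blast
  \<comment> \<open>For \<open>t \<le> t1\<close> the disc centre parameter \<open>t / l\<close> is
    at most \<open>c\<close>, the range in which interior balls are available.\<close>
  define t1 where "t1 = l * c"
  have "t1 > 0" using l \<open>c > 0\<close> by (simp add: t1_def)
  obtain \<eta>0 where \<eta>0: "\<eta>0 > 0" "ball z0 \<eta>0 \<subseteq> \<Omega>" using \<Omega>(1) z0 openE by blast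
  \<comment> \<open>The three bounds secure balls of radius \<eta> about \<open>z0\<close>, about
    the end \<open>p + t1 *\<^sub>R n\<close> of the ray, and about any \<open>q\<close> farther
    than \<open>t1\<close> from the boundary.\<close>
  define \<eta> where "\<eta> = min \<eta>0 (min ((s - (1 - l)) * c) t1)"
  have \<eta>: "\<eta> > 0" "\<eta> \<le> \<eta>0" "\<eta> \<le> (s - (1 - l)) * c" "\<eta> \<le> t1"
    using \<eta>0 s \<open>c > 0\<close> \<open>t1 > 0\<close> by (auto simp: \<eta>_def)
  have z0\<eta>: "ball z0 \<eta> \<subseteq> \<Omega>" using \<eta>0 \<eta> by (meson subset_ball order_trans)
  obtain R where R: "R > 0" "\<And>x. x \<in> \<Omega> \<Longrightarrow> norm x \<le> R" using \<Omega>(2) bounded_pos by blast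
  have diam: "norm (x - y) \<le> 2 * R" if "x \<in> \<Omega>" "y \<in> \<Omega>" for x y
    using norm_triangle_ineq4[of x y] R(2)[OF that(1)] R(2)[OF that(2)] by linarith
  define D where "D = 2 * R / \<eta>"
  \<comment> \<open>\<open>D\<close> bounds the final segment and \<open>ln t1\<close> comes from
    the integral along the normal. The term with \<open>2 * R\<close>, a bound for the boundary
    distance, compensates a negative \<open>ln (1 / bdist \<Omega> q)\<close>.\<close>
  define B where "B = D + (1 + \<epsilon>) / 2 * (\<bar>ln t1\<bar> + \<bar>ln (2 * R)\<bar>) + 1"
  have "D > 0" using R \<eta> by (simp add: D_def)
  then have "B > 0" using \<open>\<epsilon> > 0\<close> by (auto simp: B_def intro!: add_pos_nonneg add_nonneg_pos)
  have end_le: "norm (z0 - x) / \<eta> \<le> D" if "x \<in> \<Omega>" for x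
    unfolding D_def using diam[OF z0 that] \<eta>(1) by (intro divide_right_mono) auto
  have "kobayashi_dist \<Omega> q z0 \<le> ereal (B + (1 + \<epsilon>) / 2 * ln (1 / bdist \<Omega> q))" if q: "q \<in> \<Omega>" for q
  proof -
    define \<delta> where "\<delta> = bdist \<Omega> q"
    obtain p where p: "p \<in> frontier \<Omega>" "\<delta> = dist q p" "\<delta> > 0" "ball q \<delta> \<subseteq> \<Omega>"
      using bdist_attained[OF dom q] unfolding \<delta>_def by blast
    show ?thesis
    proof (cases "\<delta> \<le> t1")
      case True
      define n where "n = (1 / \<delta>) *\<^sub>R (q - p)"
      have n: "norm n = 1" "q = p + \<delta> *\<^sub>R n" using p(2,3) by (auto simp: n_def dist_norm)
      have balls: "ball (p + c' *\<^sub>R n) (s * c') \<subseteq> \<Omega>" if "0 < c'" "c' \<le> c" for c'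
        using c[of p n \<delta> c'] p(1,3,4) n that by simp
      \<comment> \<open>Since \<open>n\<close> is a unit vector,
        \<open>norm (z *s n) = cmod z\<close>. The complex line through \<open>p\<close> in
        direction \<open>n\<close> therefore meets each of the balls, centred on it, in a disc of
        the same radius.\<close>
      have disc: "p + z *s n \<in> \<Omega>" if "cmod (z - of_real (t / l)) < s * (t / l)" "0 < t" "t \<le> t1" for z t
      proof -
        have "p + (t / l) *\<^sub>R n - (p + z *s n) = (of_real (t / l) - z) *s n"
          by (simp add: of_real_vector_scalar_mult[symmetric] vector_sub_rdistrib)
        then have "norm (p + (t / l) *\<^sub>R n - (p + z *s n)) = cmod (of_real (t / l) - z)"
          using n(1) by (simp only: norm_vector_scalar_mult mult_1_right)
        then have "p + z *s n \<in> ball (p + (t / l) *\<^sub>R n) (s * (t / l))"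
          using that(1) by (simp add: dist_norm norm_minus_commute)
        moreover have "0 < t / l" "t / l \<le> c" using that l by (auto simp: t1_def field_simps)
        ultimately show ?thesis using balls by blast
      qed
      have ecc: "\<bar>t - t / l\<bar> < s * (t / l)" if "0 < t" for t
        using eccentric_disc_metric_le(1)[OF that l(1,2)] by (simp add: s_def)
      have inside: "p + t *\<^sub>R n \<in> \<Omega>" if "0 < t" "t \<le> t1" for t
        using disc[of "of_real t" t] ecc[OF that(1)] that
        by (simp add: of_real_vector_scalar_mult flip: of_real_diff of_real_divide)
      have "ball (p + t1 *\<^sub>R n) ((s - (1 - l)) * c) \<subseteq> ball (p + c *\<^sub>R n) (s * c)"
      proof -
        have "dist (p + t1 *\<^sub>R n) (p + c *\<^sub>R n) = norm ((t1 - c) *\<^sub>R n)"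
          by (simp add: dist_norm algebra_simps)
        also have "\<dots> = (1 - l) * c"
        proof -
          have "t1 - c = - ((1 - l) * c)" by (simp add: t1_def algebra_simps)
          then show ?thesis using n(1) l \<open>c > 0\<close> by simp
        qed
        finally show ?thesis by (simp add: ball_subset_ball_iff algebra_simps)
      qed
      also have "\<dots> \<subseteq> \<Omega>" using balls \<open>c > 0\<close> by simp
      finally have x\<eta>: "ball (p + t1 *\<^sub>R n) \<eta> \<subseteq> \<Omega>" using \<eta>(3) by (meson subset_ball order_trans)
      define L where "L = (1 + \<epsilon>) / 2 * ln (t1 / \<delta>)"
      have "L \<ge> 0" using True p(3) \<open>\<epsilon> > 0\<close> by (simp add: L_def)
      have "kobayashi_dist \<Omega> (p + \<delta> *\<^sub>R n) z0 \<le> ereal (L + norm (z0 - (p + t1 *\<^sub>R n)) / \<eta>)"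
      proof (rule kobayashi_dist_broken_line_le[where g = "\<lambda>t. (1 + \<epsilon>) / 2 / t"])
        show "p + t *\<^sub>R n \<in> \<Omega>" if "t \<in> {\<delta>..t1}" for t
          using inside that p(3) by simp
        show "kobayashi_metric \<Omega> (p + t *\<^sub>R n) n \<le> (1 + \<epsilon>) / 2 / t" if "t \<in> {\<delta><..<t1}" for t
        proof -
          have t: "0 < t" "t \<le> t1" using that p(3) by auto
          have "kobayashi_metric \<Omega> (p + t *\<^sub>R n) n \<le> s * (t / l) / ((s * (t / l))\<^sup>2 - (t - t / l)\<^sup>2)"
            by (rule kobayashi_metric_affine_disc_le[OF disc ecc]) (use t in auto)
          also have "\<dots> \<le> (1 + l) / (1 - l) / (2 * t)"
            using eccentric_disc_metric_le(2)[OF t(1) l(1,2)] by (simp add: s_def)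
          finally show ?thesis by (simp add: l(3))
        qed
        show "(\<integral>\<^sup>+ t\<in>{\<delta>..t1}. ennreal ((1 + \<epsilon>) / 2 / t) \<partial>lebesgue) \<le> ennreal L"
          using nn_integral_const_over_id[OF p(3) True, of "(1 + \<epsilon>) / 2"] \<open>\<epsilon> > 0\<close> by (simp add: L_def)
      qed (use True \<Omega> \<open>L \<ge> 0\<close> \<eta>(1) x\<eta> z0\<eta> in auto)
      also have "\<dots> \<le> ereal (B + (1 + \<epsilon>) / 2 * ln (1 / \<delta>))"
      proof -
        have "L = (1 + \<epsilon>) / 2 * ln t1 + (1 + \<epsilon>) / 2 * ln (1 / \<delta>)"
        proof -
          have "ln (t1 / \<delta>) = ln t1 + ln (1 / \<delta>)" using p(3) \<open>t1 > 0\<close> by (simp add: ln_div)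
          then show ?thesis by (simp only: L_def distrib_left)
        qed
        moreover have "(1 + \<epsilon>) / 2 * ln t1 \<le> (1 + \<epsilon>) / 2 * (\<bar>ln t1\<bar> + \<bar>ln (2 * R)\<bar>)"
          using \<open>\<epsilon> > 0\<close> by (intro mult_left_mono) auto
        moreover have "norm (z0 - (p + t1 *\<^sub>R n)) / \<eta> \<le> D"
          using inside \<open>t1 > 0\<close> by (intro end_le) auto
        ultimately have "L + norm (z0 - (p + t1 *\<^sub>R n)) / \<eta> \<le> B + (1 + \<epsilon>) / 2 * ln (1 / \<delta>)"
          unfolding B_def by linarith
        then show ?thesis by simp
      qed
      finally show ?thesis
        by (simp only: n(2)[symmetric] \<delta>_def[symmetric])
    next
      case False
      then have q\<eta>: "ball q \<eta> \<subseteq> \<Omega>" using p(4) \<eta>(4) by (meson less_imp_le not_le order_trans subset_ball)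
      \<comment> \<open>Away from the boundary the ray is degenerate, with both parameters 0 and
        direction 0, and only the segment from \<open>q\<close> to \<open>z0\<close>
        remains.\<close>
      have "kobayashi_dist \<Omega> (q + 0 *\<^sub>R 0) z0 \<le> ereal (0 + norm (z0 - (q + 0 *\<^sub>R 0)) / \<eta>)"
        by (rule kobayashi_dist_broken_line_le[where g = "\<lambda>_. 0"]) (use \<Omega> \<eta>(1) q\<eta> z0\<eta> q in auto)
      also have "\<dots> \<le> ereal (B + (1 + \<epsilon>) / 2 * ln (1 / \<delta>))"
      proof -
        have "p \<in> closure \<Omega>" using p(1) by (simp add: frontier_def)
        moreover have "closure \<Omega> \<subseteq> cball 0 R" using R(2) by (intro closure_minimal) auto
        ultimately have "norm p \<le> R" by auto
        then have "\<delta> \<le> 2 * R"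
          using p(2) norm_triangle_ineq4[of q p] R(2)[OF q] by (simp add: dist_norm)
        then have "ln \<delta> \<le> ln (2 * R)" using p(3) R(1) by simp
        then have "- \<bar>ln (2 * R)\<bar> \<le> ln (1 / \<delta>)" using p(3) by (simp add: ln_div)
        then have "(1 + \<epsilon>) / 2 * (- (\<bar>ln t1\<bar> + \<bar>ln (2 * R)\<bar>)) \<le> (1 + \<epsilon>) / 2 * ln (1 / \<delta>)"
          using \<open>\<epsilon> > 0\<close> by (intro mult_left_mono) auto
        moreover have "norm (z0 - q) / \<eta> \<le> D" using q by (rule end_le)
        ultimately have "norm (z0 - q) / \<eta> \<le> B + (1 + \<epsilon>) / 2 * ln (1 / \<delta>)"
          unfolding B_def mult_minus_right by linarith
        then show ?thesis by simp
      qed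
      finally show ?thesis by (simp add: \<delta>_def)
    qed
  qed
  then show ?thesis using \<open>B > 0\<close> by blast
qed

section \<open>Lower bounds from supporting half spaces\<close>

text \<open>The Cayley transform taking \<open>f 0\<close> to 0 maps the right half plane into the
  unit disc and has derivative \<open>1 / (2 * Re (f 0))\<close> at \<open>f 0\<close>; the Schwarz
  lemma applies to the composition.\<close>

lemma Schwarz_half_plane:
  assumes hol: "f holomorphic_on ball 0 1" and pos: "\<And>z. cmod z < 1 \<Longrightarrow> Re (f z) > 0"
  shows "cmod (deriv f 0) \<le> 2 * Re (f 0)"
proof -
  define w where "w = f 0"
  have "Re w > 0" using pos[of 0] by (simp add: w_def)
  have ww: "w + cnj w = of_real (2 * Re w)" by (simp add: complex_add_cnj)
  define \<phi> where "\<phi> z = (f z - w) / (f z + cnj w)" for z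
  have nz: "f z + cnj w \<noteq> 0" if "cmod z < 1" for z
  proof
    assume "f z + cnj w = 0"
    then have "Re (f z + cnj w) = 0" by simp
    then show False using pos[OF that] \<open>Re w > 0\<close> by simp
  qed
  have "\<phi> holomorphic_on ball 0 1"
    unfolding \<phi>_def using nz by (intro holomorphic_intros hol) auto
  moreover have "\<phi> 0 = 0" by (simp add: \<phi>_def w_def)
  moreover have "cmod (\<phi> z) < 1" if z: "cmod z < 1" for z
  proof -
    have "(cmod (f z + cnj w))\<^sup>2 - (cmod (f z - w))\<^sup>2 = 4 * Re (f z) * Re w"
      unfolding cmod_power2 by (simp add: power2_eq_square algebra_simps)
    moreover have "4 * Re (f z) * Re w > 0" using pos[OF z] \<open>Re w > 0\<close> by simp
    ultimately have "(cmod (f z - w))\<^sup>2 < (cmod (f z + cnj w))\<^sup>2" by linarith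
    then have "cmod (f z - w) < cmod (f z + cnj w)" by (rule power_less_imp_less_base) simp
    then show ?thesis using nz[OF z] by (simp add: \<phi>_def norm_divide)
  qed
  ultimately have le: "cmod (deriv \<phi> 0) \<le> 1"
    using Schwarz_Lemma(2)[of \<phi> 0] by simp
  have "(f has_field_derivative deriv f 0) (at 0)"
    using hol by (intro holomorphic_derivI[of f "ball 0 1"]) auto
  then have "(\<phi> has_field_derivative deriv f 0 / (w + cnj w)) (at 0)"
    unfolding \<phi>_def using nz[of 0]
    by (auto intro!: derivative_eq_intros simp: w_def)
  then have "deriv \<phi> 0 = deriv f 0 / of_real (2 * Re w)"
    unfolding ww by (rule DERIV_imp_deriv)
  then have "cmod (deriv \<phi> 0) = cmod (deriv f 0) / (2 * Re w)"
    using \<open>Re w > 0\<close> by (simp only: norm_divide norm_of_real)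
  then show ?thesis using le \<open>Re w > 0\<close> by (simp add: w_def field_simps)
qed

text \<open>A real linear functional is thereby the real part of a complex linear one, whose
  composition with a holomorphic disc is again holomorphic.\<close>

lemma inner_complex_vec_eq_Re:
  fixes n v :: "complex ^ 'd"
  shows "n \<bullet> v = Re (\<Sum>i\<in>UNIV. v $ i * cnj (n $ i))"
  by (simp add: inner_vec_def inner_complex_def algebra_simps)

text \<open>The complex linear functional with real part \<open>n \<bullet> (z - p)\<close> turns a
  competing disc into a holomorphic map to the right half plane, where the Schwarz bound limits its
  derivative.\<close>

lemma kobayashi_metric_half_space_ge:
  fixes \<Omega> :: "(complex ^ 'd) set"
  assumes "open \<Omega>" "x \<in> \<Omega>" and half: "\<And>z. z \<in> \<Omega> \<Longrightarrow> n \<bullet> (z - p) > 0"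
  shows "\<bar>n \<bullet> v\<bar> / (2 * (n \<bullet> (x - p))) \<le> kobayashi_metric \<Omega> x v"
  unfolding kobayashi_metric_def
proof (rule cInf_greatest)
  obtain \<eta> where "\<eta> > 0" "ball x \<eta> \<subseteq> \<Omega>" using assms openE by blast
  then show "{cmod \<zeta> |\<zeta>. \<exists>f. holomorphic_vec f (ball 0 1) \<and> f ` ball 0 1 \<subseteq> \<Omega> \<and>
      f 0 = x \<and> \<zeta> *s deriv_vec f 0 = v} \<noteq> {}"
    using ball_competitor[of x \<eta> \<Omega> v] by blast
next
  fix r assume "r \<in> {cmod \<zeta> |\<zeta>. \<exists>f. holomorphic_vec f (ball 0 1) \<and> f ` ball 0 1 \<subseteq> \<Omega> \<and>
      f 0 = x \<and> \<zeta> *s deriv_vec f 0 = v}"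
  then obtain \<zeta> f where r: "r = cmod \<zeta>" and f: "holomorphic_vec f (ball 0 1)" "f ` ball 0 1 \<subseteq> \<Omega>"
      "f 0 = x" "\<zeta> *s deriv_vec f 0 = v"
    by blast
  define F where "F z = (\<Sum>i\<in>UNIV. (f z $ i - p $ i) * cnj (n $ i))" for z
  have ReF: "Re (F z) = n \<bullet> (f z - p)" for z
    by (simp add: F_def inner_complex_vec_eq_Re)
  have comp: "(\<lambda>z. f z $ i) holomorphic_on ball 0 1" for i
    using f(1) by (simp add: holomorphic_vec_def)
  have "F holomorphic_on ball 0 1"
    unfolding F_def by (intro holomorphic_intros comp)
  moreover have "Re (F z) > 0" if "cmod z < 1" for z
    unfolding ReF using that f(2) by (intro half) auto
  ultimately have "cmod (deriv F 0) \<le> 2 * Re (F 0)" by (rule Schwarz_half_plane)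
  then have le: "cmod (deriv F 0) \<le> 2 * (n \<bullet> (x - p))" by (simp add: ReF f(3))
  have "((\<lambda>z. f z $ i) has_field_derivative deriv (\<lambda>z. f z $ i) 0) (at 0)" for i
    using comp[of i] by (intro holomorphic_derivI[of _ "ball 0 1"]) auto
  then have "(F has_field_derivative (\<Sum>i\<in>UNIV. deriv_vec f 0 $ i * cnj (n $ i))) (at 0)"
    unfolding F_def by (auto intro!: derivative_eq_intros simp: deriv_vec_def)
  then have "deriv F 0 = (\<Sum>i\<in>UNIV. deriv_vec f 0 $ i * cnj (n $ i))" by (rule DERIV_imp_deriv)
  then have "\<zeta> * deriv F 0 = (\<Sum>i\<in>UNIV. v $ i * cnj (n $ i))"
    by (simp add: f(4)[symmetric] sum_distrib_left mult_ac)
  then have "n \<bullet> v = Re (\<zeta> * deriv F 0)" by (simp add: inner_complex_vec_eq_Re)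
  then have "\<bar>n \<bullet> v\<bar> \<le> cmod (\<zeta> * deriv F 0)" using abs_Re_le_cmod by metis
  also have "\<dots> \<le> r * (2 * (n \<bullet> (x - p)))"
    unfolding norm_mult r by (intro mult_left_mono le) auto
  finally show "\<bar>n \<bullet> v\<bar> / (2 * (n \<bullet> (x - p))) \<le> r"
    using half[OF \<open>x \<in> \<Omega>\<close>] by (simp add: field_simps)
qed

text \<open>The function \<open>ln (n \<bullet> (z - p)) / 2\<close> has derivative at most the
  metric in absolute value, so along a curve its increment is at most the length.\<close>

lemma kobayashi_dist_half_space_ge:
  fixes \<Omega> :: "(complex ^ 'd) set"
  assumes "open \<Omega>" and half: "\<And>z. z \<in> \<Omega> \<Longrightarrow> n \<bullet> (z - p) > 0"
  shows "ereal (\<bar>ln (n \<bullet> (y - p)) - ln (n \<bullet> (x - p))\<bar> / 2) \<le> kobayashi_dist \<Omega> x y" (is "ereal ?L \<le> _")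
proof -
  have "ennreal ?L \<le> kobayashi_length \<Omega> a b \<sigma>"
    if "a < b" and ac: "abs_continuous_curve a b \<sigma>" and im: "\<sigma> ` {a..b} \<subseteq> \<Omega>" and ends: "\<sigma> a = x" "\<sigma> b = y"
    for a b \<sigma>
  proof -
    define u where "u t = n \<bullet> (\<sigma> t - p)" for t
    define w where "w t = ln (u t) / 2" for t
    have u_pos: "u t > 0" if "t \<in> {a..b}" for t
      using half im that unfolding u_def by blast
    have "continuous_on {a..b} u"
      unfolding u_def using abs_continuous_curve_imp_continuous_on[OF ac] by (intro continuous_intros)
    \<comment> \<open>A positive minimum \<open>m\<close> of \<open>u\<close> on the compact
      interval makes the logarithm Lipschitz on the values taken, so \<open>w\<close> inherits
      absolute continuity.\<close>
    then obtain t0 where t0: "t0 \<in> {a..b}" "\<And>t. t \<in> {a..b} \<Longrightarrow> u t0 \<le> u t"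
      using continuous_attains_inf[of "{a..b}" u] \<open>a < b\<close> by auto
    define m where "m = u t0"
    have "m > 0" using u_pos t0 by (simp add: m_def)
    have m_le: "m \<le> u t" if "t \<in> {a..b}" for t using t0(2)[OF that] by (simp add: m_def)
    have ln_le: "ln r - ln s \<le> \<bar>r - s\<bar> / m" if "m \<le> s" "m \<le> r" for r s
    proof -
      have "ln r - ln s \<le> (r - s) / s" using that \<open>m > 0\<close> by (intro ln_diff_le) auto
      also have "\<dots> \<le> \<bar>r - s\<bar> / s" using that \<open>m > 0\<close> by (intro divide_right_mono) auto
      also have "\<dots> \<le> \<bar>r - s\<bar> / m" using that \<open>m > 0\<close> by (intro divide_left_mono) auto
      finally show ?thesis .
    qed
    have "abs_continuous_curve a b w"
    proof (rule abs_continuous_curve_dominated[OF ac])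
      fix s t assume "a \<le> s" "s \<le> t" "t \<le> b"
      then have "m \<le> u s" "m \<le> u t" using m_le by auto
      then have "\<bar>ln (u t) - ln (u s)\<bar> \<le> \<bar>u t - u s\<bar> / m"
        using ln_le[of "u s" "u t"] ln_le[of "u t" "u s"] by (simp add: abs_minus_commute abs_le_iff)
      also have "u t - u s = n \<bullet> (\<sigma> t - \<sigma> s)" by (simp add: u_def inner_diff_right)
      also have "\<bar>n \<bullet> (\<sigma> t - \<sigma> s)\<bar> / m \<le> norm n * norm (\<sigma> t - \<sigma> s) / m"
        using \<open>m > 0\<close> by (intro divide_right_mono Cauchy_Schwarz_ineq2) auto
      finally have "\<bar>ln (u t) - ln (u s)\<bar> \<le> norm n / m * norm (\<sigma> t - \<sigma> s)" by simp
      moreover have "norm (w t - w s) = \<bar>ln (u t) - ln (u s)\<bar> / 2"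
        by (simp add: w_def diff_divide_distrib[symmetric])
      moreover have "\<bar>ln (u t) - ln (u s)\<bar> / 2 \<le> \<bar>ln (u t) - ln (u s)\<bar>" by simp
      ultimately have "norm (w t - w s) \<le> norm n / m * norm (\<sigma> t - \<sigma> s)"
        by (metis order_trans)
      then show "norm (w t - w s) \<le> norm n / m * norm (\<sigma> t - \<sigma> s) + 0 * (t - s)" by simp
    qed
    \<comment> \<open>Off the null set of points without derivative,
      \<open>vector_derivative\<close> is the true derivative and the chain rule applies.\<close>
    moreover have "\<exists>D. (w has_real_derivative D) (at t) \<and>
        ennreal \<bar>D\<bar> \<le> ennreal (kobayashi_metric \<Omega> (\<sigma> t) (vector_derivative \<sigma> (at t)))"
      if t: "t \<in> {a<..<b} - {t \<in> {a<..<b}. \<not> \<sigma> differentiable at t}" for t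
    proof -
      define v where "v = vector_derivative \<sigma> (at t)"
      have "(\<sigma> has_vector_derivative v) (at t)"
        using t unfolding v_def by (auto simp: vector_derivative_works[symmetric])
      then have "(\<sigma> has_derivative (\<lambda>h. h *\<^sub>R v)) (at t)" by (simp add: has_vector_derivative_def)
      then have "(u has_derivative (\<lambda>h. n \<bullet> (h *\<^sub>R v))) (at t)"
        unfolding u_def by (auto intro!: derivative_eq_intros)
      then have "(u has_real_derivative n \<bullet> v) (at t)"
        by (simp add: has_field_derivative_def mult_commute_abs)
      moreover have tab: "t \<in> {a..b}" using t by auto
      ultimately have "(w has_real_derivative (n \<bullet> v) / (2 * u t)) (at t)"
        unfolding w_def using u_pos[OF tab] by (auto intro!: derivative_eq_intros)
      moreover have "\<bar>(n \<bullet> v) / (2 * u t)\<bar> \<le> kobayashi_metric \<Omega> (\<sigma> t) v"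
      proof -
        have "\<sigma> t \<in> \<Omega>" using im tab by blast
        from kobayashi_metric_half_space_ge[OF \<open>open \<Omega>\<close> this half, of v] show ?thesis
          using u_pos[OF tab] by (simp add: u_def)
      qed
      ultimately show ?thesis unfolding v_def by (blast intro: ennreal_leI)
    qed
    ultimately have "ennreal \<bar>w b - w a\<bar> \<le> kobayashi_length \<Omega> a b \<sigma>"
      unfolding kobayashi_length_def
      using \<open>a < b\<close> abs_continuous_curve_differentiable_ae[OF ac]
      by (intro abs_continuous_curve_increment_le_nn_integral) auto
    moreover have "\<bar>w b - w a\<bar> = ?L"
      by (simp add: w_def u_def ends diff_divide_distrib[symmetric])
    ultimately show ?thesis by simp
  qed
  then have "ennreal ?L \<le> Inf {kobayashi_length \<Omega> a b \<sigma> | a b \<sigma>.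
      a < b \<and> abs_continuous_curve a b \<sigma> \<and> \<sigma> ` {a..b} \<subseteq> \<Omega> \<and> \<sigma> a = x \<and> \<sigma> b = y}"
    by (intro Inf_greatest) blast
  then show ?thesis
    unfolding kobayashi_dist_def by (simp add: less_eq_ennreal.rep_eq)
qed

text \<open>Separation gives a weak inequality. Openness makes it strict: \<open>z\<close> can be
  moved a little towards the hyperplane, and the moved point still satisfies the weak one.\<close>

lemma supporting_half_space:
  fixes \<Omega> :: "'a::euclidean_space set"
  assumes "open \<Omega>" "convex \<Omega>" "\<Omega> \<noteq> {}" "p \<notin> \<Omega>"
  obtains n where "\<And>z. z \<in> \<Omega> \<Longrightarrow> n \<bullet> (z - p) > 0"
proof -
  obtain n c where n: "n \<noteq> 0" "n \<bullet> p \<le> c" "\<And>z. z \<in> \<Omega> \<Longrightarrow> c \<le> n \<bullet> z"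
    using separating_hyperplane_sets[of "{p}" \<Omega>] assms by auto
  have "n \<bullet> (z - p) > 0" if z: "z \<in> \<Omega>" for z
  proof -
    obtain e where e: "e > 0" "ball z e \<subseteq> \<Omega>" using assms z openE by blast
    define h where "h = (e / (2 * norm n)) *\<^sub>R n"
    have "norm h < e" using e n(1) by (simp add: h_def)
    then have "z - h \<in> \<Omega>" using e by (auto simp: dist_norm)
    then have "c \<le> n \<bullet> (z - h)" by (rule n(3))
    moreover have "n \<bullet> h > 0" using e n(1) by (simp add: h_def)
    ultimately show ?thesis using n(2) by (simp add: inner_diff_right)
  qed
  then show thesis by (rule that)
qed

section \<open>The exponent cannot lie below one\<close>

theorem alpha_regular_imp_ge_1:
  fixes \<Omega> :: "(complex ^ 'd) set"
  assumes dom: "bounded_convex_domain \<Omega>" and reg: "alpha_regular \<alpha> \<Omega>" and "\<alpha> > 0"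
  shows "\<alpha> \<ge> 1"
proof (rule ccontr)
  assume "\<not> \<alpha> \<ge> 1"
  have \<Omega>: "open \<Omega>" "convex \<Omega>" "\<Omega> \<noteq> {}" using dom by (auto simp: bounded_convex_domain_def)
  obtain z0 where z0: "z0 \<in> \<Omega>" using \<Omega> by blast
  obtain r where r: "r > 0" "ball z0 r \<subseteq> \<Omega>" using \<Omega> z0 openE by blast
  obtain p where p: "p \<in> frontier \<Omega>" using bdist_attained[OF dom z0] by blast
  have out: "x \<notin> \<Omega>" if "x \<in> frontier \<Omega>" for x
    using that \<Omega>(1) frontier_disjoint_eq[of \<Omega>] by blast
  obtain n where n: "\<And>z. z \<in> \<Omega> \<Longrightarrow> n \<bullet> (z - p) > 0"
    using supporting_half_space[OF \<Omega> out[OF p]] by blast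
  obtain B where B: "B > 0"
      "\<And>q. q \<in> \<Omega> \<Longrightarrow> kobayashi_dist \<Omega> q z0 \<le> ereal (B + \<alpha> / 2 * ln (1 / bdist \<Omega> q))"
    using reg z0 unfolding alpha_regular_def by blast
  have key: "X / 2 \<le> B + \<alpha> / 2 * (X - ln r)" if "X > 0" for X
  proof -
    \<comment> \<open>At the point \<open>q\<close> at ratio \<open>exp (- X)\<close> on the segment
      from \<open>p\<close> to \<open>z0\<close>, the lower bound for the distance is exactly
      \<open>X / 2\<close>. The shrunken ball about \<open>q\<close> gives
      \<open>bdist \<Omega> q \<ge> exp (- X) * r\<close>, so regularity allows at most
      \<open>\<alpha> / 2 * X\<close> plus a constant.\<close>
    define s where "s = exp (- X)"
    have s: "0 < s" "s < 1" using that by (auto simp: s_def)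
    define q where "q = p + s *\<^sub>R (z0 - p)"
    have ball: "ball q (s * r) \<subseteq> \<Omega>"
      unfolding q_def using convex_ball_shrink[OF \<Omega>(2,1), of p "z0 - p" r s] p r s
      by (simp add: frontier_def)
    then have q: "q \<in> \<Omega>" using s r by (meson centre_in_ball mult_pos_pos subsetD)
    obtain p' where p': "p' \<in> frontier \<Omega>" "bdist \<Omega> q = dist q p'" "bdist \<Omega> q > 0"
      using bdist_attained[OF dom q] by blast
    have "p' \<notin> ball q (s * r)" using ball out[OF p'(1)] by blast
    then have "s * r \<le> bdist \<Omega> q" by (simp add: p'(2))
    then have "ln (s * r) \<le> ln (bdist \<Omega> q)" using s(1) r(1) by (intro ln_mono) auto
    then have le: "ln (1 / bdist \<Omega> q) \<le> X - ln r"
      using s r p'(3) by (simp add: ln_div ln_mult s_def)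
    have "n \<bullet> (q - p) = s * (n \<bullet> (z0 - p))" by (simp add: q_def)
    then have "ln (n \<bullet> (q - p)) = - X + ln (n \<bullet> (z0 - p))"
      using n[OF z0] s by (simp add: ln_mult s_def)
    then have "ereal (X / 2) \<le> kobayashi_dist \<Omega> q z0"
      using kobayashi_dist_half_space_ge[OF \<Omega>(1) n, of z0 q] that by simp
    also have "\<dots> \<le> ereal (B + \<alpha> / 2 * ln (1 / bdist \<Omega> q))" using q by (rule B(2))
    finally have "X / 2 \<le> B + \<alpha> / 2 * ln (1 / bdist \<Omega> q)" by simp
    also have "\<dots> \<le> B + \<alpha> / 2 * (X - ln r)"
      using le \<open>\<alpha> > 0\<close> by (intro add_left_mono mult_left_mono) auto
    finally show ?thesis .
  qed
  \<comment> \<open>Chosen with \<open>(1 - \<alpha>) * (X - 1) = 2 * B + \<alpha> * \<bar>ln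
    r\<bar>\<close>, so that \<open>key\<close> would give
    \<open>(1 - \<alpha>) * X \<le> (1 - \<alpha>) * (X - 1)\<close>.\<close>
  define X where "X = (2 * B + \<alpha> * \<bar>ln r\<bar>) / (1 - \<alpha>) + 1"
  have "1 - \<alpha> > 0" using \<open>\<not> \<alpha> \<ge> 1\<close> by simp
  have "X > 0" using \<open>1 - \<alpha> > 0\<close> B(1) \<open>\<alpha> > 0\<close> by (auto simp: X_def intro!: add_nonneg_pos divide_nonneg_pos)
  then have "X / 2 \<le> B + \<alpha> / 2 * (X - ln r)" by (rule key)
  then have "(1 - \<alpha>) * X \<le> 2 * B - \<alpha> * ln r" by (simp add: field_simps)
  also have "\<dots> \<le> 2 * B + \<alpha> * \<bar>ln r\<bar>"
    using mult_left_mono[of "- ln r" "\<bar>ln r\<bar>" \<alpha>] \<open>\<alpha> > 0\<close> by simp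
  also have "\<dots> = (1 - \<alpha>) * (X - 1)" using \<open>1 - \<alpha> > 0\<close> by (simp add: X_def)
  finally show False using \<open>1 - \<alpha> > 0\<close> by (simp add: algebra_simps)
qed

theorem proposition16p2:
  fixes \<Omega> :: "(complex ^ 'd) set"
  assumes "bounded_convex_domain \<Omega>"
    and "C1_boundary \<Omega>"
  shows "(\<forall>\<epsilon>>0. \<forall>z0\<in>\<Omega>. \<exists>B>0. \<forall>q\<in>\<Omega>.
            kobayashi_dist \<Omega> q z0 \<le> ereal (B + (1 + \<epsilon>) / 2 * ln (1 / bdist \<Omega> q)))
         \<and> alpha_star \<Omega> = 1"
proof (intro conjI)
  show upper: "\<forall>\<epsilon>>0. \<forall>z0\<in>\<Omega>. \<exists>B>0. \<forall>q\<in>\<Omega>.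
      kobayashi_dist \<Omega> q z0 \<le> ereal (B + (1 + \<epsilon>) / 2 * ln (1 / bdist \<Omega> q))"
    using C1_convex_domain_kobayashi_dist_le[OF assms] by blast
  let ?S = "{\<alpha>. \<alpha> > 0 \<and> alpha_regular \<alpha> \<Omega>}"
  have mem: "1 + \<epsilon> \<in> ?S" if "\<epsilon> > 0" for \<epsilon>
    using upper that by (simp add: alpha_regular_def)
  have ge: "1 \<le> \<alpha>" if "\<alpha> \<in> ?S" for \<alpha>
    using that alpha_regular_imp_ge_1[OF assms(1)] by blast
  \<comment> \<open>The infimum is that of a set of reals: one inequality relies on the set being
    bounded below, the other on it having a member, found at \<epsilon> = 1.\<close>
  have "Inf ?S \<le> 1"
  proof (rule field_le_epsilon)
    show "Inf ?S \<le> 1 + \<epsilon>" if "\<epsilon> > 0" for \<epsilon>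
      by (rule cInf_lower[OF mem[OF that]]) (rule bdd_belowI[OF ge])
  qed
  moreover have "1 \<le> Inf ?S"
  proof (rule cInf_greatest[OF _ ge])
    show "?S \<noteq> {}" using mem[OF zero_less_one] by blast
  qed
  ultimately show "alpha_star \<Omega> = 1" by (simp add: alpha_star_def)
qed

end
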